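(* Suppose that, as $q\to\infty$, both $\log q/\log x\to\infty$ and $\log x/\sqrt{\log q\,\log\log q}\to\infty$. Then there exists a non-principal character $\chi \pmod q$ for which $$\frac{1}{\sqrt{x}}\left|\sum_{n\le x}\chi(n)\right|\gg\left(\frac{\log x}{\sqrt{\log q\,\log\log q}}\right)^{(1+o(1))\frac{\log q}{\log x}}.$$
   Context: $\chi$ is a Dirichlet character modulo $q$; $o(1)$ refers to $q\to\infty$. *)

theory Defs
  imports Complex_Main
begin

(* A Dirichlet character is taken as its q-periodic, completely multiplicative extension to the
   integers, vanishing exactly off the residues coprime to q. *)
definition dirichlet_character :: "nat \<Rightarrow> (int \<Rightarrow> complex) \<Rightarrow> bool" where
  "dirichlet_character q \<chi> \<longleftrightarrow>
     q > 0 \<and>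
     (\<forall>n. \<chi> (n + int q) = \<chi> n) \<and>
     (\<forall>m n. \<chi> (m * n) = \<chi> m * \<chi> n) \<and>
     (\<forall>n. \<chi> n \<noteq> 0 \<longleftrightarrow> coprime n (int q))"

definition principal_character :: "nat \<Rightarrow> int \<Rightarrow> complex" where
  "principal_character q n = (if coprime n (int q) then 1 else 0)"

definition character_sum :: "(int \<Rightarrow> complex) \<Rightarrow> real \<Rightarrow> complex" where
  "character_sum \<chi> x = (\<Sum>n\<in>{n::nat. 1 \<le> n \<and> real n \<le> x}. \<chi> (int n))"

end

(* The resonance method. For a resonator R(chi) = sum over a in A of r(a) chi(a), comparing the
   second moments over all characters of S R and of R, where S is the character sum, shows that some
   |S|^2 exceeds the ratio of the number of weighted solutions of m a = n b to the sum of r(a)^2, up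
   to the contribution of the principal character. Take for A the products of J distinct primes p
   from a window (W, W^8] with W about (log q)^2 and p not dividing q, and r(a) = a^(-1/2).
   Representing h s, with s a product of J + j such primes and h prime, as (h b) (s / b) with b | s
   having j prime factors, the Cauchy-Schwarz inequality bounds the ratio below by
   x (J sigma / (2 j^2))^j up to powers of log q, where sigma, the sum of 1/p over the window, is
   bounded below by a constant. With J of order j^2 the gain is exponential in j, and j can be taken
   as large as (log q / log x) L^(1/2), where L is the base in the theorem. This beats
   L^(2 log q / log x), so the theorem holds even with epsilon = 0 and c = 1. *)
theory Submission
  imports Defs "HOL-Real_Asymp.Real_Asymp" "HOL-Analysis.Convex" "HOL-Number_Theory.Number_Theory"
begin

section \<open>Characters of the unit group\<close>

text \<open>Three size constraints fix the parameters. The products a must stay below q, so that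
  congruence modulo q among them is equality and the second moment of R is diagonal. The principal
  character adds at most x^2 |A|, relative to the number of characters, so |A| and x must be small
  powers of q. A product b of j primes must stay below sqrt x, so that the free prime h still ranges
  up to x / b >= sqrt x. As log p has the order of log log q, the first constraint asks that j^2 log
  log q be small against log q; for j about (log q / log x) L^(1/2) it is of order (log q) / L,
  which is where the growth of L enters. Crude prime estimates suffice: factorials determine the sum
  of (log p) / p up to a factor 2 on either side, and the eighth power in the window absorbs that
  loss. With W about (log q)^2, dropping the prime divisors of q, or the primes already used in a
  product, costs only a small part of sigma. Taking h above W^8 keeps it apart from the window, so
  that h s determines h and s.\<close>

text \<open>A homomorphism on a subgroup of the unit group modulo \<open>q\<close>, with
  \<open>H\<close> the union of the residue classes in the subgroup; integers stand for their
  classes. Inverses in \<open>H\<close> come from Euler's theorem.\<close>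

definition partial_character :: "nat \<Rightarrow> int set \<Rightarrow> (int \<Rightarrow> complex) \<Rightarrow> bool" where
  "partial_character q H f \<longleftrightarrow>
     1 \<in> H \<and> f 1 = 1 \<and>
     (\<forall>a\<in>H. coprime a (int q)) \<and>
     (\<forall>a\<in>H. \<forall>b\<in>H. a * b \<in> H \<and> f (a * b) = f a * f b) \<and>
     (\<forall>a\<in>H. \<forall>b. [b = a] (mod int q) \<longrightarrow> b \<in> H \<and> f b = f a)"

lemma int_euler_theorem:
  fixes a :: int
  assumes "q > 0" "coprime a (int q)"
  shows "[a ^ totient q = 1] (mod int q)"
proof -
  define b where "b = nat (a mod int q)"
  have b: "int b = a mod int q"
    using assms by (simp add: b_def)
  have "coprime (int b) (int q)"
    using assms by (simp add: b coprime_mod_left_iff)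
  then have "[b ^ totient q = 1] (mod q)"
    by (intro euler_theorem) simp
  then have "[int b ^ totient q = 1] (mod int q)"
    by (metis cong_int_iff of_nat_1 of_nat_power)
  moreover have "[a ^ totient q = int b ^ totient q] (mod int q)"
    by (intro cong_pow) (simp add: b cong_def)
  ultimately show ?thesis
    using cong_trans by blast
qed

lemma partial_character_one:
  "partial_character q H f \<Longrightarrow> 1 \<in> H"
  "partial_character q H f \<Longrightarrow> f 1 = 1"
  unfolding partial_character_def by blast+

lemma partial_character_coprime:
  "partial_character q H f \<Longrightarrow> a \<in> H \<Longrightarrow> coprime a (int q)"
  unfolding partial_character_def by blast

lemma partial_character_mult:
  "partial_character q H f \<Longrightarrow> a \<in> H \<Longrightarrow> b \<in> H \<Longrightarrow> a * b \<in> H"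
  "partial_character q H f \<Longrightarrow> a \<in> H \<Longrightarrow> b \<in> H \<Longrightarrow> f (a * b) = f a * f b"
  unfolding partial_character_def by blast+

lemma partial_character_cong:
  "partial_character q H f \<Longrightarrow> a \<in> H \<Longrightarrow> [b = a] (mod int q) \<Longrightarrow> b \<in> H"
  "partial_character q H f \<Longrightarrow> a \<in> H \<Longrightarrow> [b = a] (mod int q) \<Longrightarrow> f b = f a"
  unfolding partial_character_def by blast+

lemma partial_character_pow:
  assumes "partial_character q H f" "a \<in> H"
  shows "a ^ n \<in> H \<and> f (a ^ n) = f a ^ n"
  using partial_character_one[OF assms(1)] partial_character_mult[OF assms(1) assms(2)]
  by (induction n) simp_all

lemma partial_character_inverse:
  assumes "q > 0" "partial_character q H f" "a \<in> H"
  obtains b where "b \<in> H" "[a * b = 1] (mod int q)" "f a * f b = 1"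
proof -
  have c: "coprime a (int q)"
    using partial_character_coprime assms(2,3) .
  have t: "totient q > 0"
    using assms by simp
  have e: "[a * a ^ (totient q - 1) = 1] (mod int q)"
    using int_euler_theorem[OF assms(1) c] t by (simp add: power_eq_if)
  have b: "a ^ (totient q - 1) \<in> H"
    using partial_character_pow assms by blast
  have "f (a * a ^ (totient q - 1)) = f 1"
    using partial_character_cong(2)[OF assms(2) partial_character_one(1)[OF assms(2)] e] .
  then have "f a * f (a ^ (totient q - 1)) = 1"
    using partial_character_mult(2)[OF assms(2,3) b] partial_character_one(2)[OF assms(2)] by simp
  with b e that show ?thesis by blast
qed

lemma partial_character_divide:
  assumes "q > 0" "partial_character q H f" "a \<in> H" "[a * b = c] (mod int q)" "c \<in> H"
  shows "b \<in> H \<and> f c = f a * f b"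
proof -
  obtain a' where a': "a' \<in> H" "[a * a' = 1] (mod int q)" "f a * f a' = 1"
    using partial_character_inverse assms by blast
  have "[b = (a * a') * b] (mod int q)"
    using cong_scalar_right[OF a'(2), of b] by (simp add: cong_sym)
  also have "(a * a') * b = a' * (a * b)" by simp
  also have "[a' * (a * b) = a' * c] (mod int q)"
    using assms(4) by (rule cong_scalar_left)
  finally have b: "[b = a' * c] (mod int q)" .
  have "a' * c \<in> H" "f (a' * c) = f a' * f c"
    using partial_character_mult[OF assms(2)] a' assms by blast+
  with b have "b \<in> H" "f b = f a' * f c"
    using partial_character_cong[OF assms(2)] by metis+
  moreover have "f a * (f a' * f c) = f c"
    using a'(3) by (metis mult.assoc mult_1)
  ultimately show ?thesis by simp
qed

lemma partial_character_order_dvd: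
  assumes q: "q > 0" and H: "partial_character q H f"
    and d: "d > 0" "g ^ d \<in> H" "\<And>e. 0 < e \<Longrightarrow> e < d \<Longrightarrow> g ^ e \<notin> H"
    and e: "g ^ e \<in> H"
  shows "d dvd e"
proof (rule ccontr)
  assume "\<not> d dvd e"
  then have r: "0 < e mod d" "e mod d < d"
    using d by (auto simp: mod_greater_zero_iff_not_dvd)
  have "g ^ (d * (e div d)) \<in> H"
    using partial_character_pow[OF H d(2)] by (simp add: power_mult)
  moreover have "g ^ (d * (e div d)) * g ^ (e mod d) = g ^ e"
    by (simp add: power_add[symmetric])
  ultimately have "g ^ (e mod d) \<in> H"
    using partial_character_divide[OF q H _ _ e] by auto
  with d(3)[OF r] show False by simp
qed

text \<open>Adjoining one unit \<open>g\<close> of order \<open>d\<close> modulo \<open>H\<close>: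
  the new elements are \<open>h * g ^ i\<close>, with value \<open>f h * c ^ i\<close>. The relation
  \<open>c ^ d = f (g ^ d)\<close> is exactly what makes this independent of the
  representation.\<close>

lemma partial_character_extend:
  assumes q: "q > 0" and H: "partial_character q H f" and g: "coprime g (int q)"
    and d: "d > 0" "g ^ d \<in> H" "\<And>e. 0 < e \<Longrightarrow> e < d \<Longrightarrow> g ^ e \<notin> H"
    and c: "c ^ d = f (g ^ d)"
  shows "\<exists>H' f'. partial_character q H' f' \<and> H \<subseteq> H' \<and> g \<in> H' \<and> (\<forall>a\<in>H. f' a = f a) \<and> f' g = c"
proof -
  define rep where "rep n h i \<longleftrightarrow> h \<in> H \<and> [n = h * g ^ i] (mod int q)" for n h i
  define H' where "H' = {n. \<exists>h i. rep n h i}"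
  define f' where "f' n = (THE v. \<exists>h i. rep n h i \<and> v = f h * c ^ i)" for n
  \<comment> \<open>By minimality of \<open>d\<close> every such \<open>e\<close> is a multiple of
    \<open>d\<close>, so the single relation for \<open>c ^ d\<close> covers all powers of
    \<open>g\<close> in \<open>H\<close>.\<close>
  have pow: "f (g ^ e) = c ^ e" if "g ^ e \<in> H" for e
  proof -
    have "d dvd e"
      using partial_character_order_dvd[OF q H d that] .
    then show ?thesis
      using partial_character_pow[OF H d(2)] c by (auto simp: power_mult elim!: dvdE)
  qed
  \<comment> \<open>The unit \<open>g ^ i\<close> cancels, leaving \<open>h\<close> congruent to
    \<open>h' * g ^ (i' - i)\<close>. Hence \<open>g ^ (i' - i)\<close> lies in \<open>H\<close>,
    and \<open>pow\<close> gives its value.\<close>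
  have uniq_le: "f h * c ^ i = f h' * c ^ i'" if r: "rep n h i" "rep n h' i'" "i \<le> i'" for n h i h' i'
  proof -
    have "[h * g ^ i = h' * g ^ i'] (mod int q)"
      using r by (metis rep_def cong_sym cong_trans)
    then have "[h * g ^ i = (h' * g ^ (i' - i)) * g ^ i] (mod int q)"
      using r(3) by (simp add: mult.assoc power_add[symmetric])
    moreover have "coprime (g ^ i) (int q)"
      using g by simp
    ultimately have *: "[h = h' * g ^ (i' - i)] (mod int q)"
      by (simp add: cong_mult_rcancel)
    have "g ^ (i' - i) \<in> H \<and> f h = f h' * f (g ^ (i' - i))"
      using partial_character_divide[OF q H _ cong_sym[OF *]] r by (auto simp: rep_def)
    then show ?thesis
      using pow r(3) by (auto simp: mult.assoc power_add[symmetric])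
  qed
  have uniq: "f h * c ^ i = f h' * c ^ i'" if "rep n h i" "rep n h' i'" for n h i h' i'
    using uniq_le[OF that] uniq_le[OF that(2,1)] by (cases "i \<le> i'") auto
  have f': "f' n = f h * c ^ i" if "rep n h i" for n h i
    unfolding f'_def by (rule the_equality) (use that uniq in blast)+
  have rep_H: "rep h h 0" if "h \<in> H" for h
    using that by (simp add: rep_def)
  have rep_mult: "rep (a * b) (h * h') (i + i')" if "rep a h i" "rep b h' i'" for a b h h' i i'
    using that cong_mult[of a "h * g ^ i" "int q" b "h' * g ^ i'"] partial_character_mult(1)[OF H]
    by (simp add: rep_def power_add mult_ac)
  note one = partial_character_one[OF H]
  have rep_g: "rep g 1 1"
    using one by (simp add: rep_def)
  have "partial_character q H' f'"
    unfolding partial_character_def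
  proof (intro conjI ballI allI impI)
    show "1 \<in> H'" "f' 1 = 1"
      using rep_H[OF one(1)] f'[OF rep_H[OF one(1)]] one by (auto simp: H'_def)
  next
    fix a assume "a \<in> H'"
    then obtain h i where hi: "rep a h i" by (auto simp: H'_def)
    then have "coprime h (int q)"
      using partial_character_coprime[OF H] by (simp add: rep_def)
    then have "coprime (h * g ^ i) (int q)"
      using g by simp
    moreover have "[h * g ^ i = a] (mod int q)"
      using hi by (simp add: rep_def cong_sym)
    ultimately show "coprime a (int q)"
      using cong_imp_coprime by blast
  next
    fix a b assume "a \<in> H'" "b \<in> H'"
    then obtain h i h' i' where r: "rep a h i" "rep b h' i'" by (auto simp: H'_def)
    then show "a * b \<in> H'" using rep_mult by (force simp: H'_def)
    have "h \<in> H" "h' \<in> H" using r by (auto simp: rep_def)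
    then show "f' (a * b) = f' a * f' b"
      using f'[OF r(1)] f'[OF r(2)] f'[OF rep_mult[OF r]] partial_character_mult(2)[OF H]
      by (simp add: power_add mult_ac)
  next
    fix a b assume "a \<in> H'" "[b = a] (mod int q)"
    then obtain h i where "rep a h i" "rep b h i"
      unfolding H'_def rep_def using cong_trans by blast
    then show "b \<in> H'" "f' b = f' a"
      using f' by (auto simp: H'_def)
  qed
  moreover have "H \<subseteq> H'" "\<forall>a\<in>H. f' a = f a"
    using rep_H f'[OF rep_H] by (auto simp: H'_def)
  moreover have "g \<in> H'" "f' g = c"
    using rep_g f'[OF rep_g] one by (auto simp: H'_def)
  ultimately show ?thesis by blast
qed

lemma complex_root_exists:
  fixes z :: complex
  assumes "n > 0" "z \<noteq> 0"
  shows "\<exists>c. c ^ n = z"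
  using assms by (intro exI[of _ "rcis (root n (cmod z)) (Arg z / n)"]) (simp add: DeMoivre2 rcis_cmod_Arg)

lemma least_power_in:
  fixes g :: int
  assumes "q > 0" "partial_character q H f" "coprime g (int q)"
  obtains d where "d > 0" "g ^ d \<in> H" "\<And>e. 0 < e \<Longrightarrow> e < d \<Longrightarrow> g ^ e \<notin> H"
proof -
  define d where "d = (LEAST e. e > 0 \<and> g ^ e \<in> H)"
  have "totient q > 0 \<and> g ^ totient q \<in> H"
    using assms partial_character_cong(1)[OF assms(2) partial_character_one(1)[OF assms(2)]]
      int_euler_theorem[OF assms(1,3)] by simp
  then have "d > 0 \<and> g ^ d \<in> H"
    unfolding d_def by (rule LeastI)
  moreover have "g ^ e \<notin> H" if "0 < e" "e < d" for e
    using not_less_Least[of e "\<lambda>e. e > 0 \<and> g ^ e \<in> H"] that by (auto simp: d_def)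
  ultimately show ?thesis using that by blast
qed

lemma partial_character_nonzero:
  assumes "q > 0" "partial_character q H f" "a \<in> H"
  shows "f a \<noteq> 0"
  using partial_character_inverse[OF assms] by (metis mult_zero_left zero_neq_one)

text \<open>Induction on the number of residues outside \<open>H\<close>: while some unit is missing
  it can be adjoined, since complex numbers have \<open>d\<close>-th roots. Once \<open>H\<close>
  contains all units, extension by 0 is a Dirichlet character.\<close>

lemma partial_character_extends_to_character:
  assumes "q > 0" "partial_character q H f"
  shows "\<exists>\<chi>. dirichlet_character q \<chi> \<and> (\<forall>a\<in>H. \<chi> a = f a)"
  using assms(2)
proof (induction "card ({0..<int q} - H)" arbitrary: H f rule: less_induct)
  case less
  show ?case
  proof (cases "\<forall>g. coprime g (int q) \<longrightarrow> g \<in> H")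
    case True
    then have H: "a \<in> H \<longleftrightarrow> coprime a (int q)" for a
      using partial_character_coprime[OF less.prems] by blast
    define \<chi> where "\<chi> n = (if n \<in> H then f n else 0)" for n
    have "dirichlet_character q \<chi>"
      unfolding dirichlet_character_def
    proof (intro conjI allI)
      fix n
      show "\<chi> (n + int q) = \<chi> n"
      proof -
        have c: "[n + int q = n] (mod int q)" "[n = n + int q] (mod int q)"
          by (simp_all add: cong_def)
        have "n + int q \<in> H \<longleftrightarrow> n \<in> H"
          using partial_character_cong(1)[OF less.prems _ c(1)]
            partial_character_cong(1)[OF less.prems _ c(2)] by blast
        then show ?thesis
          using partial_character_cong(2)[OF less.prems _ c(1)] by (simp add: \<chi>_def)
      qed
      show "(\<chi> n \<noteq> 0) = coprime n (int q)"
        using partial_character_nonzero[OF assms(1) less.prems] by (auto simp: \<chi>_def H)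
    next
      fix m n
      show "\<chi> (m * n) = \<chi> m * \<chi> n"
        using partial_character_mult[OF less.prems] by (auto simp: \<chi>_def H)
    qed (use assms in simp)
    then show ?thesis
      by (intro exI[of _ \<chi>]) (auto simp: \<chi>_def)
  next
    case False
    then obtain g where g: "coprime g (int q)" "g \<notin> H" by blast
    obtain d where d: "d > 0" "g ^ d \<in> H" "\<And>e. 0 < e \<Longrightarrow> e < d \<Longrightarrow> g ^ e \<notin> H"
      by (rule least_power_in[OF assms(1) less.prems g(1)]) blast
    obtain c where "c ^ d = f (g ^ d)"
      using complex_root_exists d(1) partial_character_nonzero[OF assms(1) less.prems d(2)] by blast
    then obtain H' f' where H': "partial_character q H' f'" "H \<subseteq> H'" "g \<in> H'" "\<forall>a\<in>H. f' a = f a"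
      using partial_character_extend[OF assms(1) less.prems g(1) d] by blast
    have m: "[g mod int q = g] (mod int q)" by (simp add: cong_def)
    have "g mod int q \<notin> H"
      using g(2) partial_character_cong(1)[OF less.prems _ cong_sym[OF m]] by blast
    moreover have "g mod int q \<in> H'"
      using H' partial_character_cong(1) m by blast
    moreover have "g mod int q \<in> {0..<int q}"
      using assms(1) by simp
    ultimately have "{0..<int q} - H' \<subset> {0..<int q} - H"
      using H'(2) by blast
    then have "card ({0..<int q} - H') < card ({0..<int q} - H)"
      by (intro psubset_card_mono) auto
    from less.hyps[OF this H'(1)] show ?thesis
      using H' by (metis subsetD)
  qed
qed

text \<open>Start from the trivial character on the class of 1. The order \<open>d\<close> of
  \<open>g\<close> exceeds 1, so \<open>g\<close> may be sent to the primitive root of unity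
  \<open>cis (2 * pi / d)\<close>, which differs from 1, and the result extends to all
  units.\<close>

lemma characters_separate_points:
  assumes "q > 0" "coprime g (int q)" "\<not> [g = 1] (mod int q)"
  shows "\<exists>\<chi>. dirichlet_character q \<chi> \<and> \<chi> g \<noteq> 1"
proof -
  define H where "H = {n. [n = 1] (mod int q)}"
  have H: "partial_character q H (\<lambda>_. 1)"
    unfolding partial_character_def
  proof (intro conjI ballI allI impI)
    fix a b assume "a \<in> H" "b \<in> H"
    then show "a * b \<in> H"
      using cong_mult[of a 1 "int q" b 1] by (simp add: H_def)
  next
    fix a b assume "a \<in> H" "[b = a] (mod int q)"
    then show "b \<in> H"
      unfolding H_def using cong_trans by blast
  next
    fix a assume "a \<in> H"
    then show "coprime a (int q)"
      using cong_imp_coprime[OF cong_sym, of a 1 "int q"] by (simp add: H_def)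
  qed (simp_all add: H_def)
  obtain d where d: "d > 0" "g ^ d \<in> H" "\<And>e. 0 < e \<Longrightarrow> e < d \<Longrightarrow> g ^ e \<notin> H"
    by (rule least_power_in[OF assms(1) H assms(2)]) blast
  have "d \<noteq> 1"
    using d(2) assms(3) by (auto simp: H_def)
  with d(1) have "d > 1" by simp
  define c where "c = cis (2 * pi / d)"
  have "c ^ d = 1"
    using d(1) by (simp add: c_def DeMoivre)
  have "c \<noteq> 1"
  proof
    assume "c = 1"
    then have "cos (2 * pi / d) = 1" by (simp add: c_def complex_eq_iff)
    then obtain k :: int where k: "2 * pi / d = of_int k * 2 * pi"
      using cos_one_2pi_int by blast
    then have "1 = of_int k * real d"
      using d(1) by (simp add: field_simps)
    then have "1 = k * int d"
      by (metis of_int_1 of_int_eq_iff of_int_mult of_int_of_nat_eq)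
    then show False
      using \<open>d > 1\<close> by (metis dvd_triv_right nat_dvd_1_iff_1 int_dvd_int_iff of_nat_1 less_irrefl)
  qed
  obtain H' f' where H': "partial_character q H' f'" "g \<in> H'" "f' g = c"
    using partial_character_extend[OF assms(1) H assms(2) d, of c] \<open>c ^ d = 1\<close> by auto
  then obtain \<chi> where "dirichlet_character q \<chi>" "\<forall>a\<in>H'. \<chi> a = f' a"
    using partial_character_extends_to_character[OF assms(1)] by blast
  with H' \<open>c \<noteq> 1\<close> show ?thesis by auto
qed

section \<open>Elementary properties and finiteness of the set of Dirichlet characters\<close>

lemma dirichlet_character_mult:
  "dirichlet_character q \<chi> \<Longrightarrow> \<chi> (m * n) = \<chi> m * \<chi> n"
  by (simp add: dirichlet_character_def)

lemma dirichlet_character_eq_0_iff: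
  "dirichlet_character q \<chi> \<Longrightarrow> \<chi> n = 0 \<longleftrightarrow> \<not> coprime n (int q)"
  by (auto simp: dirichlet_character_def)

lemma dirichlet_character_one:
  assumes "dirichlet_character q \<chi>"
  shows "\<chi> 1 = 1"
proof -
  have "\<chi> 1 * \<chi> 1 = \<chi> 1" "\<chi> 1 \<noteq> 0"
    using dirichlet_character_mult[OF assms, of 1 1] dirichlet_character_eq_0_iff[OF assms, of 1] by auto
  then show ?thesis by simp
qed

lemma dirichlet_character_cong:
  assumes "dirichlet_character q \<chi>" "[a = b] (mod int q)"
  shows "\<chi> a = \<chi> b"
proof -
  have per: "\<chi> (n + int k * int q) = \<chi> n" for n k
  proof (induction k)
    case (Suc k)
    have "\<chi> (n + int (Suc k) * int q) = \<chi> ((n + int k * int q) + int q)"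
      by (simp add: algebra_simps)
    also have "\<dots> = \<chi> n"
      using assms(1) Suc by (simp add: dirichlet_character_def)
    finally show ?case .
  qed simp
  obtain k where k: "b = a + int q * k"
    using assms(2)[unfolded cong_iff_lin] by blast
  show ?thesis
  proof (cases "k \<ge> 0")
    case True
    then show ?thesis using per[of a "nat k"] k by (simp add: algebra_simps)
  next
    case False
    then show ?thesis using per[of b "nat (-k)"] k by (simp add: algebra_simps)
  qed
qed

lemma dirichlet_character_power:
  assumes "dirichlet_character q \<chi>"
  shows "\<chi> (a ^ n) = \<chi> a ^ n"
  by (induction n) (simp_all add: dirichlet_character_one[OF assms] dirichlet_character_mult[OF assms])

lemma dirichlet_character_root_of_unity:
  assumes "dirichlet_character q \<chi>" "coprime a (int q)"
  shows "\<chi> a ^ totient q = 1"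
proof -
  have "q > 0" using assms(1) by (simp add: dirichlet_character_def)
  from dirichlet_character_cong[OF assms(1) int_euler_theorem[OF this assms(2)]]
  show ?thesis
    by (simp add: dirichlet_character_one[OF assms(1)] dirichlet_character_power[OF assms(1)])
qed

lemma norm_dirichlet_character:
  assumes "dirichlet_character q \<chi>" "coprime a (int q)"
  shows "norm (\<chi> a) = 1"
proof -
  have "q > 0" using assms(1) by (simp add: dirichlet_character_def)
  then have t: "totient q > 0" by simp
  have "norm (\<chi> a) ^ totient q = 1"
    using dirichlet_character_root_of_unity[OF assms] by (metis norm_one norm_power)
  then show ?thesis
    using power_eq_imp_eq_base[of "norm (\<chi> a)" "totient q" 1] t by simp
qed

definition characters :: "nat \<Rightarrow> (int \<Rightarrow> complex) set" where
  "characters q = {\<chi>. dirichlet_character q \<chi>}"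

text \<open>By periodicity a character is determined by its values on \<open>{0..<int q}\<close>,
  each of which is 0 or a root of unity of order dividing \<open>totient q\<close>.\<close>

lemma finite_characters: "finite (characters q)"
proof (cases "q > 0")
  case True
  define Z where "Z = insert 0 {z::complex. z ^ totient q = 1}"
  have fin: "finite Z"
    unfolding Z_def using True by (simp add: finite_roots_unity Suc_leI)
  have "characters q \<subseteq> (\<lambda>g n. g (n mod int q)) ` ({0..<int q} \<rightarrow>\<^sub>E Z)"
  proof
    fix \<chi> assume "\<chi> \<in> characters q"
    then have \<chi>: "dirichlet_character q \<chi>" by (simp add: characters_def)
    have "\<chi> = (\<lambda>n. restrict \<chi> {0..<int q} (n mod int q))"
    proof
      fix n
      show "\<chi> n = restrict \<chi> {0..<int q} (n mod int q)"
        using True dirichlet_character_cong[OF \<chi>, of "n mod int q" n] by (simp add: cong_def)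
    qed
    moreover have "restrict \<chi> {0..<int q} \<in> {0..<int q} \<rightarrow>\<^sub>E Z"
    proof (rule restrict_PiE_iff[THEN iffD2], rule ballI)
      fix a
      show "\<chi> a \<in> Z"
        using dirichlet_character_root_of_unity[OF \<chi>, of a] dirichlet_character_eq_0_iff[OF \<chi>, of a]
        by (auto simp: Z_def)
    qed
    ultimately show "\<chi> \<in> (\<lambda>g n. g (n mod int q)) ` ({0..<int q} \<rightarrow>\<^sub>E Z)" by blast
  qed
  then show ?thesis
    by (rule finite_subset) (intro finite_imageI finite_PiE, use fin in auto)
qed (auto simp: characters_def dirichlet_character_def)

lemma principal_character_in_characters:
  "q > 0 \<Longrightarrow> principal_character q \<in> characters q"
  unfolding characters_def dirichlet_character_def principal_character_def
  by (simp add: coprime_iff_gcd_eq_1[of "_ + _"]) (simp add: coprime_iff_gcd_eq_1)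

lemma dirichlet_character_times:
  "dirichlet_character q \<chi> \<Longrightarrow> dirichlet_character q \<psi> \<Longrightarrow> dirichlet_character q (\<lambda>n. \<chi> n * \<psi> n)"
  by (simp add: dirichlet_character_def)

section \<open>Orthogonality and the number of characters\<close>

text \<open>Multiplication by a character \<open>\<psi>\<close> with
  \<open>\<psi> g \<noteq> 1\<close> permutes the characters and multiplies the sum by
  \<open>\<psi> g\<close>, which forces the sum to be 0.\<close>

lemma sum_characters:
  assumes "q > 0" "coprime g (int q)"
  shows "(\<Sum>\<chi>\<in>characters q. \<chi> g) = (if [g = 1] (mod int q) then of_nat (card (characters q)) else 0)"
proof (cases "[g = 1] (mod int q)")
  case True
  have "(\<Sum>\<chi>\<in>characters q. \<chi> g) = (\<Sum>\<chi>\<in>characters q. 1)"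
  proof (intro sum.cong refl)
    fix \<chi> assume "\<chi> \<in> characters q"
    then have \<chi>: "dirichlet_character q \<chi>" by (simp add: characters_def)
    show "\<chi> g = 1"
      using dirichlet_character_cong[OF \<chi> True] dirichlet_character_one[OF \<chi>] by simp
  qed
  with True show ?thesis by simp
next
  case False
  obtain \<psi> where \<psi>: "dirichlet_character q \<psi>" "\<psi> g \<noteq> 1"
    using characters_separate_points[OF assms False] by blast
  define F where "F \<chi> = (\<lambda>n. \<psi> n * \<chi> n)" for \<chi> :: "int \<Rightarrow> complex"
  have into: "F ` characters q \<subseteq> characters q"
    using dirichlet_character_times[OF \<psi>(1)] by (auto simp: F_def characters_def)
  have inj: "inj_on F (characters q)"
  proof (rule inj_onI, rule ext)
    fix \<chi> \<chi>' n assume *: "\<chi> \<in> characters q" "\<chi>' \<in> characters q" "F \<chi> = F \<chi>'"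
    then have "\<psi> n * \<chi> n = \<psi> n * \<chi>' n" by (metis F_def)
    with * show "\<chi> n = \<chi>' n"
      using dirichlet_character_eq_0_iff[of q \<chi> n] dirichlet_character_eq_0_iff[of q \<chi>' n]
        dirichlet_character_eq_0_iff[of q \<psi> n] \<psi>(1)
      by (cases "coprime n (int q)") (auto simp: characters_def)
  qed
  have "F ` characters q = characters q"
    using endo_inj_surj[OF finite_characters into inj] .
  then have "(\<Sum>\<chi>\<in>characters q. \<chi> g) = (\<Sum>\<chi>\<in>characters q. F \<chi> g)"
    using sum.reindex[OF inj, of "\<lambda>\<chi>. \<chi> g"] by simp
  also have "\<dots> = \<psi> g * (\<Sum>\<chi>\<in>characters q. \<chi> g)"
    by (simp add: F_def sum_distrib_left)
  finally have "(1 - \<psi> g) * (\<Sum>\<chi>\<in>characters q. \<chi> g) = 0"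
    by (simp add: algebra_simps)
  with \<psi>(2) False show ?thesis by simp
qed

text \<open>The dual argument: multiplication by a unit \<open>g\<close> with
  \<open>\<chi> g \<noteq> 1\<close> permutes the residues.\<close>

lemma sum_nonprincipal_character:
  assumes "dirichlet_character q \<chi>" "\<chi> \<noteq> principal_character q"
  shows "(\<Sum>a\<in>{0..<int q}. \<chi> a) = 0"
proof -
  have q: "q > 0" using assms(1) by (simp add: dirichlet_character_def)
  obtain g where "\<chi> g \<noteq> principal_character q g"
    using assms(2) by blast
  then have g: "coprime g (int q)" "\<chi> g \<noteq> 1"
    using dirichlet_character_eq_0_iff[OF assms(1), of g]
    by (auto simp: principal_character_def split: if_splits)
  define F where "F a = (g * a) mod int q" for a
  have inj: "inj_on F {0..<int q}"
  proof (rule inj_onI)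
    fix a b assume *: "a \<in> {0..<int q}" "b \<in> {0..<int q}" "F a = F b"
    then have "[g * a = g * b] (mod int q)" by (simp add: F_def cong_def)
    then have "[a = b] (mod int q)" using g(1) by (simp add: cong_mult_lcancel)
    with * show "a = b" by (simp add: cong_def)
  qed
  have "F ` {0..<int q} = {0..<int q}"
    by (rule endo_inj_surj[OF _ _ inj]) (use q in \<open>auto simp: F_def\<close>)
  then have "(\<Sum>a\<in>{0..<int q}. \<chi> a) = (\<Sum>a\<in>{0..<int q}. \<chi> (F a))"
    using sum.reindex[OF inj, of \<chi>] by simp
  also have "\<dots> = (\<Sum>a\<in>{0..<int q}. \<chi> g * \<chi> a)"
  proof (intro sum.cong refl)
    fix a
    have "[F a = g * a] (mod int q)" by (simp add: F_def cong_def)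
    from dirichlet_character_cong[OF assms(1) this]
    show "\<chi> (F a) = \<chi> g * \<chi> a" by (simp add: dirichlet_character_mult[OF assms(1)])
  qed
  also have "\<dots> = \<chi> g * (\<Sum>a\<in>{0..<int q}. \<chi> a)"
    by (simp add: sum_distrib_left)
  finally have "(1 - \<chi> g) * (\<Sum>a\<in>{0..<int q}. \<chi> a) = 0"
    by (simp add: algebra_simps)
  with g(2) show ?thesis by simp
qed

text \<open>Double counting of \<open>\<chi> a\<close> over all characters and residues: summed over
  \<open>a\<close> first, only the principal character survives; summed over \<open>\<chi>\<close>
  first, only the class of 1 does.\<close>

lemma card_characters:
  assumes "q > 0"
  shows "card (characters q) = card {a\<in>{0..<int q}. coprime a (int q)}"
proof -
  define U where "U = {a\<in>{0..<int q}. coprime a (int q)}"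
  have "(\<Sum>\<chi>\<in>characters q. \<Sum>a\<in>{0..<int q}. \<chi> a) =
      (\<Sum>\<chi>\<in>characters q. if \<chi> = principal_character q then of_nat (card U) else 0)"
  proof (intro sum.cong refl)
    fix \<chi> assume "\<chi> \<in> characters q"
    moreover have "(\<Sum>a\<in>{0..<int q}. principal_character q a) = of_nat (card U)"
      by (simp add: principal_character_def U_def sum.If_cases Int_def)
    ultimately show "(\<Sum>a\<in>{0..<int q}. \<chi> a) =
        (if \<chi> = principal_character q then of_nat (card U) else 0)"
      using sum_nonprincipal_character by (auto simp: characters_def)
  qed
  also have "\<dots> = of_nat (card U)"
    using principal_character_in_characters[OF assms] finite_characters by simp
  finally have 1: "(\<Sum>\<chi>\<in>characters q. \<Sum>a\<in>{0..<int q}. \<chi> a) = of_nat (card U)" .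
  \<comment> \<open>\<open>1 mod int q\<close> instead of 1 because for \<open>q = 1\<close> the
    class of 1 is represented by 0.\<close>
  have "(\<Sum>a\<in>{0..<int q}. \<Sum>\<chi>\<in>characters q. \<chi> a) =
      (\<Sum>a\<in>{0..<int q}. if a = 1 mod int q then of_nat (card (characters q)) else 0)"
  proof (intro sum.cong refl)
    fix a assume a: "a \<in> {0..<int q}"
    then have eq: "a = 1 mod int q \<longleftrightarrow> [a = 1] (mod int q)"
      by (auto simp: cong_def)
    show "(\<Sum>\<chi>\<in>characters q. \<chi> a) =
        (if a = 1 mod int q then of_nat (card (characters q)) else 0)"
    proof (cases "coprime a (int q)")
      case True
      then show ?thesis using sum_characters[OF assms True] eq by simp
    next
      case False
      then have "\<not> [a = 1] (mod int q)"
        using cong_imp_coprime[OF cong_sym, of a 1 "int q"] by auto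
      moreover have "(\<Sum>\<chi>\<in>characters q. \<chi> a) = 0"
        using False dirichlet_character_eq_0_iff[of q _ a]
        by (intro sum.neutral ballI) (metis characters_def mem_Collect_eq)
      ultimately show ?thesis using eq by simp
    qed
  qed
  also have "\<dots> = of_nat (card (characters q))"
    using assms by simp
  finally have "(of_nat (card (characters q)) :: complex) = of_nat (card U)"
    using 1 sum.swap[of "\<lambda>\<chi> a. \<chi> a" "{0..<int q}" "characters q"] by metis
  then show ?thesis by (simp add: U_def)
qed

lemma characters_orthogonal:
  assumes "q > 0" "coprime c (int q)" "coprime d (int q)"
  shows "(\<Sum>\<chi>\<in>characters q. \<chi> c * cnj (\<chi> d)) =
    (if [c = d] (mod int q) then of_nat (card (characters q)) else 0)"
proof -
  obtain d' where d': "[d * d' = 1] (mod int q)"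
    using cong_solve_coprime_int[OF assms(3)] by blast
  have cop: "coprime d' (int q)"
    using cong_imp_coprime[OF cong_sym[OF d']] by simp
  have "\<chi> c * cnj (\<chi> d) = \<chi> (c * d')" if "\<chi> \<in> characters q" for \<chi>
  proof -
    have \<chi>: "dirichlet_character q \<chi>" using that by (simp add: characters_def)
    have 1: "\<chi> d * \<chi> d' = 1"
      using dirichlet_character_cong[OF \<chi> d'] dirichlet_character_one[OF \<chi>]
        dirichlet_character_mult[OF \<chi>] by simp
    have "\<chi> d * cnj (\<chi> d) = 1"
      using norm_dirichlet_character[OF \<chi> assms(3)] by (simp add: complex_norm_square[symmetric])
    with 1 have "cnj (\<chi> d) = \<chi> d'"
      by (metis mult_cancel_left mult_zero_left zero_neq_one)
    then show ?thesis by (simp add: dirichlet_character_mult[OF \<chi>])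
  qed
  then have "(\<Sum>\<chi>\<in>characters q. \<chi> c * cnj (\<chi> d)) = (\<Sum>\<chi>\<in>characters q. \<chi> (c * d'))"
    by simp
  also have "\<dots> = (if [c * d' = 1] (mod int q) then of_nat (card (characters q)) else 0)"
    using sum_characters[OF assms(1)] assms(2) cop by simp
  also have "[c * d' = 1] (mod int q) \<longleftrightarrow> [c * d' = d * d'] (mod int q)"
    using d' cong_trans cong_sym by blast
  also have "\<dots> \<longleftrightarrow> [c = d] (mod int q)"
    using cop by (simp add: cong_mult_rcancel)
  finally show ?thesis .
qed

lemma sum_norm_square_characters:
  fixes f :: "nat \<Rightarrow> real"
  assumes "q > 0" "finite C" "\<And>c. c \<in> C \<Longrightarrow> coprime c q"
  shows "(\<Sum>\<chi>\<in>characters q. norm (\<Sum>c\<in>C. of_real (f c) * \<chi> (int c)) ^ 2) =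
    real (card (characters q)) * (\<Sum>c\<in>C. \<Sum>d\<in>{d\<in>C. [c = d] (mod q)}. f c * f d)"
proof -
  have "complex_of_real (\<Sum>\<chi>\<in>characters q. norm (\<Sum>c\<in>C. of_real (f c) * \<chi> (int c)) ^ 2) =
      (\<Sum>\<chi>\<in>characters q. \<Sum>c\<in>C. \<Sum>d\<in>C. of_real (f c * f d) * (\<chi> (int c) * cnj (\<chi> (int d))))"
    by (simp only: of_real_sum complex_norm_square) (simp add: sum_product mult_ac)
  also have "\<dots> = (\<Sum>c\<in>C. \<Sum>d\<in>C. \<Sum>\<chi>\<in>characters q. of_real (f c * f d) * (\<chi> (int c) * cnj (\<chi> (int d))))"
    by (subst sum.swap, intro sum.cong refl, rule sum.swap)
  also have "\<dots> = (\<Sum>c\<in>C. \<Sum>d\<in>C. of_real (f c * f d) *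
      (\<Sum>\<chi>\<in>characters q. \<chi> (int c) * cnj (\<chi> (int d))))"
    by (simp add: sum_distrib_left)
  also have "\<dots> = (\<Sum>c\<in>C. \<Sum>d\<in>C. if [c = d] (mod q) then
      of_real (real (card (characters q)) * (f c * f d)) else 0)"
    using assms by (intro sum.cong refl) (auto simp: characters_orthogonal cong_int_iff)
  also have "\<dots> = (\<Sum>c\<in>C. \<Sum>d\<in>{d\<in>C. [c = d] (mod q)}. of_real (real (card (characters q)) * (f c * f d)))"
    by (simp only: sum.inter_filter[OF assms(2)])
  also have "\<dots> = of_real (real (card (characters q)) * (\<Sum>c\<in>C. \<Sum>d\<in>{d\<in>C. [c = d] (mod q)}. f c * f d))"
    by (simp add: sum_distrib_left)
  finally show ?thesis
    by (simp only: of_real_eq_iff)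
qed

section \<open>The resonance inequality\<close>

lemma square_sum_le_card_sum_squares:
  fixes f :: "'a \<Rightarrow> real"
  shows "(\<Sum>a\<in>A. f a) ^ 2 \<le> real (card A) * (\<Sum>a\<in>A. f a ^ 2)"
  using Cauchy_Schwarz_ineq_sum[of "\<lambda>_. 1" f A] by simp

text \<open>If all non-principal sums satisfied \<open>|S|^2 \<le> V\<close>, the second moment of
  \<open>S R\<close> would be at most \<open>V\<close> times that of \<open>R\<close> plus the
  principal term. From below that moment is at least the number of characters times the sum of
  \<open>\<nu> c ^ 2\<close>, for any chosen set \<open>C\<close> of integers coprime to
  \<open>q\<close>; \<open>large\<close> contradicts this.\<close>

lemma resonance_method:
  fixes r :: "nat \<Rightarrow> real"
  assumes q: "q > 0" and fin: "finite M" "finite A" "finite C"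
    and A: "\<And>a. a \<in> A \<Longrightarrow> coprime a q \<and> a < q \<and> r a \<ge> 0"
    and C: "\<And>c. c \<in> C \<Longrightarrow> coprime c q"
    and V: "V \<ge> 0"
    and large: "(V + real (card M) ^ 2 * real (card A) / real (card (characters q))) * (\<Sum>a\<in>A. r a ^ 2)
      < (\<Sum>c\<in>C. (\<Sum>(m, a)\<in>{(m, a)\<in>M \<times> A. m * a = c}. r a) ^ 2)"
  shows "\<exists>\<chi>. dirichlet_character q \<chi> \<and> \<chi> \<noteq> principal_character q \<and>
    norm (\<Sum>m\<in>M. \<chi> (int m)) ^ 2 > V"
proof (rule ccontr)
  assume neg: "\<not> ?thesis"
  define X where "X = characters q"
  define S where "S \<chi> = (\<Sum>m\<in>M. \<chi> (int m))" for \<chi> :: "int \<Rightarrow> complex"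
  define R where "R \<chi> = (\<Sum>a\<in>A. of_real (r a) * \<chi> (int a))" for \<chi> :: "int \<Rightarrow> complex"
  define \<nu> where "\<nu> c = (\<Sum>(m, a)\<in>{(m, a)\<in>M \<times> A. m * a = c}. r a)" for c
  \<comment> \<open>Adding \<open>C\<close> gives \<open>C \<subseteq> D\<close> without asking that
    members of \<open>C\<close> be products; those that are not have \<open>\<nu> c = 0\<close>.
    Products not coprime to \<open>q\<close> may be dropped since every character vanishes
    there.\<close>
  define D where "D = {c \<in> (\<lambda>(m, a). m * a) ` (M \<times> A). coprime c q} \<union> C"
  define N where "N = real (card X)"
  have finX: "finite X" by (simp add: X_def finite_characters)
  have \<chi>\<^sub>0: "principal_character q \<in> X"
    using principal_character_in_characters[OF q] by (simp add: X_def)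
  have N: "N > 0"
    using finX \<chi>\<^sub>0 by (auto simp: N_def card_gt_0_iff)
  have finD: "finite D"
    using fin by (auto simp: D_def)
  have \<nu>_nonneg: "\<nu> c \<ge> 0" for c
    unfolding \<nu>_def using A by (intro sum_nonneg) auto
  have SR: "S \<chi> * R \<chi> = (\<Sum>c\<in>D. of_real (\<nu> c) * \<chi> (int c))" if "\<chi> \<in> X" for \<chi>
  proof -
    have \<chi>: "dirichlet_character q \<chi>" using that by (simp add: X_def characters_def)
    define E where "E = (\<lambda>(m, a). m * a) ` (M \<times> A) \<union> C"
    have finE: "finite E" using fin by (auto simp: E_def)
    have "S \<chi> * R \<chi> = (\<Sum>(m, a)\<in>M \<times> A. of_real (r a) * \<chi> (int (m * a)))"
      by (simp add: S_def R_def sum_product sum.cartesian_product dirichlet_character_mult[OF \<chi>] mult_ac)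
    also have "\<dots> = (\<Sum>c\<in>E. \<Sum>(m, a)\<in>{p\<in>M \<times> A. (\<lambda>(m, a). m * a) p = c}. of_real (r a) * \<chi> (int (m * a)))"
      using finE fin by (intro sum.group[symmetric]) (auto simp: E_def)
    also have "\<dots> = (\<Sum>c\<in>E. of_real (\<nu> c) * \<chi> (int c))"
      unfolding \<nu>_def of_real_sum sum_distrib_right
      by (intro sum.cong) auto
    also have "\<dots> = (\<Sum>c\<in>D. of_real (\<nu> c) * \<chi> (int c))"
      using dirichlet_character_eq_0_iff[OF \<chi>]
      by (intro sum.mono_neutral_right finE) (auto simp: D_def E_def)
    finally show ?thesis .
  qed
  have copD: "coprime c q" if "c \<in> D" for c
    using that C by (auto simp: D_def)
  have "N * (\<Sum>c\<in>C. \<nu> c ^ 2) \<le> N * (\<Sum>c\<in>D. \<nu> c ^ 2)"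
    using N finD by (intro mult_left_mono sum_mono2) (auto simp: D_def)
  \<comment> \<open>All \<open>\<nu>\<close> are nonnegative, so the solutions of
    \<open>c = d\<close> alone bound those of the congruence from below.\<close>
  also have "\<dots> \<le> N * (\<Sum>c\<in>D. \<Sum>d\<in>{d\<in>D. [c = d] (mod q)}. \<nu> c * \<nu> d)"
  proof (intro mult_left_mono sum_mono)
    fix c assume "c \<in> D"
    then show "\<nu> c ^ 2 \<le> (\<Sum>d\<in>{d\<in>D. [c = d] (mod q)}. \<nu> c * \<nu> d)"
      using member_le_sum[of c "{d\<in>D. [c = d] (mod q)}" "\<lambda>d. \<nu> c * \<nu> d"] finD \<nu>_nonneg
      by (simp add: power2_eq_square)
  qed (use N in simp)
  also have "\<dots> = (\<Sum>\<chi>\<in>X. norm (S \<chi> * R \<chi>) ^ 2)"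
    using sum_norm_square_characters[OF q finD copD] by (simp add: SR N_def X_def)
  also have "\<dots> = (\<Sum>\<chi>\<in>X. norm (S \<chi>) ^ 2 * norm (R \<chi>) ^ 2)"
    by (simp add: norm_mult power_mult_distrib)
  also have "\<dots> = norm (S (principal_character q)) ^ 2 * norm (R (principal_character q)) ^ 2 +
      (\<Sum>\<chi>\<in>X - {principal_character q}. norm (S \<chi>) ^ 2 * norm (R \<chi>) ^ 2)"
    by (rule sum.remove[OF finX \<chi>\<^sub>0])
  also have "\<dots> \<le> real (card M) ^ 2 * (real (card A) * (\<Sum>a\<in>A. r a ^ 2)) + V * (N * (\<Sum>a\<in>A. r a ^ 2))"
  proof (rule add_mono)
    have le1: "norm (principal_character q n) \<le> 1" for n
      by (simp add: principal_character_def)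
    have "norm (S (principal_character q)) \<le> real (card M)"
      unfolding S_def using le1 by (intro sum_norm_le[THEN order_trans, OF order_refl]) 
         (simp_all add: sum_bounded_above[where K = 1, simplified])
    moreover have "norm (R (principal_character q)) \<le> (\<Sum>a\<in>A. r a)"
      unfolding R_def using A le1
      by (intro sum_norm_le) (simp add: norm_mult mult_left_le)
    then have "norm (R (principal_character q)) ^ 2 \<le> (\<Sum>a\<in>A. r a) ^ 2"
      by (intro power_mono) auto
    then have "norm (R (principal_character q)) ^ 2 \<le> real (card A) * (\<Sum>a\<in>A. r a ^ 2)"
      using square_sum_le_card_sum_squares order_trans by blast
    ultimately show "norm (S (principal_character q)) ^ 2 * norm (R (principal_character q)) ^ 2
        \<le> real (card M) ^ 2 * (real (card A) * (\<Sum>a\<in>A. r a ^ 2))"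
      by (intro mult_mono power_mono) auto
  next
    have "(\<Sum>\<chi>\<in>X - {principal_character q}. norm (S \<chi>) ^ 2 * norm (R \<chi>) ^ 2) \<le>
        (\<Sum>\<chi>\<in>X - {principal_character q}. V * norm (R \<chi>) ^ 2)"
      using neg by (intro sum_mono mult_right_mono) (auto simp: X_def characters_def S_def not_less)
    also have "\<dots> \<le> (\<Sum>\<chi>\<in>X. V * norm (R \<chi>) ^ 2)"
      using finX V by (intro sum_mono2) auto
    also have "\<dots> = V * (N * (\<Sum>c\<in>A. \<Sum>d\<in>{d\<in>A. [c = d] (mod q)}. r c * r d))"
      using sum_norm_square_characters[OF q fin(2), of r] A
      by (simp add: sum_distrib_left[symmetric] R_def N_def X_def)
    \<comment> \<open>Here \<open>a < q\<close> on \<open>A\<close> enters: distinct elements of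
      \<open>A\<close> are incongruent.\<close>
    also have "(\<Sum>c\<in>A. \<Sum>d\<in>{d\<in>A. [c = d] (mod q)}. r c * r d) = (\<Sum>c\<in>A. r c ^ 2)"
    proof (intro sum.cong refl)
      fix c assume "c \<in> A"
      then have "{d\<in>A. [c = d] (mod q)} = {c}"
        using A by (auto simp: cong_def)
      then show "(\<Sum>d\<in>{d\<in>A. [c = d] (mod q)}. r c * r d) = r c ^ 2"
        by (simp add: power2_eq_square)
    qed
    finally show "(\<Sum>\<chi>\<in>X - {principal_character q}. norm (S \<chi>) ^ 2 * norm (R \<chi>) ^ 2)
        \<le> V * (N * (\<Sum>a\<in>A. r a ^ 2))" .
  qed
  also have "\<dots> = N * ((V + real (card M) ^ 2 * real (card A) / N) * (\<Sum>a\<in>A. r a ^ 2))"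
    using N by (simp add: field_simps)
  finally have "(\<Sum>c\<in>C. \<nu> c ^ 2) \<le> (V + real (card M) ^ 2 * real (card A) / N) * (\<Sum>a\<in>A. r a ^ 2)"
    using N by simp
  with large show False
    by (simp add: \<nu>_def N_def X_def)
qed

section \<open>Elementary prime number estimates\<close>

text \<open>From \<open>n\<close> to \<open>Suc n\<close> the quotient by \<open>d\<close> grows by
  1 exactly when \<open>d\<close> divides \<open>Suc n\<close>, and the von Mangoldt function summed
  over the divisors of \<open>Suc n\<close> is its logarithm.\<close>

lemma ln_fact_eq_sum_mangoldt:
  "ln (fact n :: real) = (\<Sum>d=1..n. mangoldt d * real (n div d))"
proof (induction n)
  case (Suc n)
  have "(\<Sum>d=1..Suc n. mangoldt d * real (Suc n div d)) =
      (\<Sum>d=1..Suc n. mangoldt d * real (n div d)) + (\<Sum>d=1..Suc n. if d dvd Suc n then mangoldt d else 0)"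
    unfolding sum.distrib[symmetric]
    by (intro sum.cong refl) (auto simp: div_Suc dvd_eq_mod_eq_0 algebra_simps)
  also have "(\<Sum>d=1..Suc n. if d dvd Suc n then mangoldt d else 0) = (\<Sum>d | d dvd Suc n. mangoldt d :: real)"
    by (rule sum.mono_neutral_cong_right) (auto simp: dvd_imp_le Suc_le_eq intro: dvd_pos_nat[of "Suc n"])
  also have "\<dots> = ln (real (Suc n))"
    by (subst mangoldt_sum) simp_all
  finally show ?case
    using Suc.IH by (simp add: ln_mult)
qed simp

lemma finite_prime_powers_le:
  fixes p :: nat
  assumes "prime p"
  shows "finite {k. p ^ Suc k \<le> n}"
proof (rule finite_subset)
  show "{k. p ^ Suc k \<le> n} \<subseteq> {..n}"
  proof
    fix k assume "k \<in> {k. p ^ Suc k \<le> n}"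
    moreover have "Suc k < p ^ Suc k"
      using prime_gt_Suc_0_nat[OF assms] by (rule power_gt_expt)
    ultimately show "k \<in> {..n}" by simp
  qed
qed simp

text \<open>Unique factorization enumerates prime powers as \<open>p ^ Suc k\<close>; counting
  \<open>k\<close> from 0 starts the exponents at 1.\<close>

lemma sum_mangoldt_eq_sum_primes:
  fixes f :: "nat \<Rightarrow> real"
  shows "(\<Sum>d=1..n. mangoldt d * f d) =
    (\<Sum>p | prime p \<and> p \<le> n. ln (real p) * (\<Sum>k | p ^ Suc k \<le> n. f (p ^ Suc k)))"
proof -
  define T where "T = (SIGMA p:{p. prime p \<and> p \<le> n}. {k. p ^ Suc k \<le> n})"
  have inj: "inj_on (\<lambda>(p::nat,k). p ^ Suc k) (Collect prime \<times> (UNIV :: nat set))"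
    by (rule bij_betw_imp_inj_on[OF bij_betw_primepows])
  have "(\<Sum>d=1..n. mangoldt d * f d) = (\<Sum>d\<in>(\<lambda>(p,k). p ^ Suc k) ` T. mangoldt d * f d)"
  proof (rule sum.mono_neutral_right)
    show "(\<lambda>(p,k). p ^ Suc k) ` T \<subseteq> {1..n}"
      by (auto simp: T_def Suc_le_eq prime_gt_0_nat simp del: power_Suc)
    show "\<forall>d\<in>{1..n} - (\<lambda>(p,k). p ^ Suc k) ` T. mangoldt d * f d = 0"
    proof
      fix d assume d: "d \<in> {1..n} - (\<lambda>(p,k). p ^ Suc k) ` T"
      have "\<not> primepow d"
      proof
        assume "primepow d"
        then have "d \<in> (\<lambda>(p,k). p ^ Suc k) ` (Collect prime \<times> UNIV)"
          unfolding bij_betw_imp_surj_on[OF bij_betw_primepows] by simp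
        then obtain p k where pk: "prime p" "d = p ^ Suc k" by auto
        then have "p \<le> d"
          using self_le_power[of p "Suc k"] prime_ge_1_nat[of p] by simp
        moreover have "d \<le> n" using d by simp
        ultimately have "(p, k) \<in> T"
          using pk by (simp add: T_def del: power_Suc)
        then have "d \<in> (\<lambda>(p,k). p ^ Suc k) ` T"
          unfolding pk(2) by (rule rev_image_eqI) simp
        with d show False by blast
      qed
      then show "mangoldt d * f d = 0" by (simp add: mangoldt_def)
    qed
  qed simp
  also have "\<dots> = (\<Sum>(p,k)\<in>T. mangoldt (p ^ Suc k) * f (p ^ Suc k))"
    by (subst sum.reindex[OF inj_on_subset[OF inj]]) (auto simp: T_def case_prod_unfold)
  also have "\<dots> = (\<Sum>p | prime p \<and> p \<le> n. \<Sum>k | p ^ Suc k \<le> n. mangoldt (p ^ Suc k) * f (p ^ Suc k))"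
    unfolding T_def using finite_prime_powers_le by (intro sum.Sigma[symmetric]) (auto simp del: power_Suc)
  also have "\<dots> = (\<Sum>p | prime p \<and> p \<le> n. ln (real p) * (\<Sum>k | p ^ Suc k \<le> n. f (p ^ Suc k)))"
    by (intro sum.cong refl) (simp add: mangoldt_primepow sum_distrib_left del: power_Suc)
  finally show ?thesis .
qed

lemma ln_fact_ge: "real n * ln (real n) - real n \<le> ln (fact n :: real)"
proof (induction n)
  case (Suc n)
  show ?case
  proof (cases "n = 0")
    case False
    have "real n * (ln (real (Suc n)) - ln (real n)) \<le> 1"
    proof -
      have "1 + 1 / real n = real (Suc n) / real n"
        using False by (simp add: field_simps)
      then have "ln (real (Suc n)) - ln (real n) = ln (1 + 1 / real n)"
        using ln_div[of "real (Suc n)" "real n"] False by simp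
      also have "\<dots> \<le> 1 / real n"
        by (intro ln_add_one_self_le_self) simp
      finally show ?thesis using False by (simp add: field_simps)
    qed
    then have "real (Suc n) * ln (real (Suc n)) - real (Suc n) \<le>
        ln (real (Suc n)) + (real n * ln (real n) - real n)"
      by (simp add: algebra_simps)
    also have "\<dots> \<le> ln (fact (Suc n))"
      using Suc.IH by (simp add: ln_mult)
    finally show ?thesis .
  qed simp
qed simp

lemma ln_fact_le: "ln (fact n :: real) \<le> real n * ln (real n)"
proof (cases "n = 0")
  case False
  have "(fact n :: real) \<le> real n ^ n"
    using fact_le_power[of n] by simp
  then have "ln (fact n :: real) \<le> ln (real n ^ n)"
    using False by (simp add: fact_gt_zero)
  then show ?thesis using False by (simp add: ln_realpow)
qed simp

text \<open>A weak form of Mertens' first theorem. In Legendre's formula for \<open>fact n\<close>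
  the powers of \<open>p\<close> form a geometric series of ratio at most 1/2, so they contribute at
  most twice the first term; this is the factor lost.\<close>

lemma sum_ln_prime_over_prime_lower:
  assumes "n > 0"
  shows "(ln (real n) - 1) / 2 \<le> (\<Sum>p | prime p \<and> p \<le> n. ln (real p) / real p)"
proof -
  have "real n * ln (real n) - real n \<le> (\<Sum>d=1..n. mangoldt d * real (n div d))"
    using ln_fact_ge ln_fact_eq_sum_mangoldt by metis
  also have "\<dots> = (\<Sum>p | prime p \<and> p \<le> n. ln (real p) * (\<Sum>k | p ^ Suc k \<le> n. real (n div p ^ Suc k)))"
    by (rule sum_mangoldt_eq_sum_primes)
  also have "\<dots> \<le> (\<Sum>p | prime p \<and> p \<le> n. ln (real p) * (2 * real n / real p))"
  proof (intro sum_mono mult_left_mono)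
    fix p assume "p \<in> {p. prime p \<and> p \<le> n}"
    then have p: "prime p" by simp
    define x where "x = 1 / real p"
    have x: "0 < x" "x \<le> 1 / 2"
      using prime_ge_2_nat[OF p] by (auto simp: x_def field_simps)
    have "(\<Sum>k | p ^ Suc k \<le> n. real (n div p ^ Suc k)) \<le> (\<Sum>k | p ^ Suc k \<le> n. real n * x * x ^ k)"
    proof (intro sum_mono)
      fix k
      have "real (n div p ^ Suc k) \<le> real n / real (p ^ Suc k)"
        by (rule of_nat_div_le_of_nat)
      then show "real (n div p ^ Suc k) \<le> real n * x * x ^ k"
        by (simp add: x_def power_divide)
    qed
    also have "\<dots> = real n * x * (\<Sum>k | p ^ Suc k \<le> n. x ^ k)"
      by (simp add: sum_distrib_left)
    also have "\<dots> \<le> real n * x * 2"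
    proof (rule mult_left_mono)
      have "(\<Sum>k | p ^ Suc k \<le> n. x ^ k) \<le> (\<Sum>k. x ^ k)"
        using x finite_prime_powers_le[OF p] by (intro sum_le_suminf summable_geometric) auto
      also have "(\<Sum>k. x ^ k) = 1 / (1 - x)"
        using x by (intro suminf_geometric) auto
      also have "1 / (1 - x) \<le> 2"
        using x by (simp add: field_simps)
      finally show "(\<Sum>k | p ^ Suc k \<le> n. x ^ k) \<le> 2" .
    qed (use x in simp)
    finally show "(\<Sum>k | p ^ Suc k \<le> n. real (n div p ^ Suc k)) \<le> 2 * real n / real p"
      by (simp add: x_def mult.commute)
  next
    fix p assume "p \<in> {p. prime p \<and> p \<le> n}"
    then show "0 \<le> ln (real p)" using prime_ge_1_nat[of p] by simp
  qed
  also have "\<dots> = 2 * real n * (\<Sum>p | prime p \<and> p \<le> n. ln (real p) / real p)"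
    by (simp add: sum_distrib_left mult_ac)
  finally have "real n * (ln (real n) - 1) \<le> real n * (2 * (\<Sum>p | prime p \<and> p \<le> n. ln (real p) / real p))"
    by (simp add: algebra_simps)
  then show ?thesis using assms by simp
qed

text \<open>In Legendre's formula only the terms with \<open>d\<close> prime are kept. For
  \<open>p \<le> n\<close> the integer quotient is at least half of the true one, whence the factor
  2.\<close>

lemma sum_ln_prime_over_prime_upper:
  "(\<Sum>p | prime p \<and> p \<le> n. ln (real p) / real p) \<le> 2 * ln (real n)"
proof (cases "n = 0")
  case True
  then have "{p. prime p \<and> p \<le> n} = {}" by auto
  with True show ?thesis by simp
next
  case False
  have "(\<Sum>p | prime p \<and> p \<le> n. mangoldt p * (real n / (2 * real p))) \<le>
      (\<Sum>p | prime p \<and> p \<le> n. mangoldt p * real (n div p))"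
  proof (intro sum_mono mult_left_mono mangoldt_nonneg)
    fix p assume "p \<in> {p. prime p \<and> p \<le> n}"
    then have p: "0 < p" "p \<le> n" using prime_gt_0_nat by auto
    have "n < p * (n div p) + p"
      using p dividend_less_times_div[of p n] by simp
    moreover have "p * 1 \<le> p * (n div p)"
      using p by (intro mult_left_mono) (auto simp: Suc_le_eq div_greater_zero_iff)
    ultimately have "real n \<le> 2 * (real p * real (n div p))"
      unfolding of_nat_mult[symmetric] by linarith
    then show "real n / (2 * real p) \<le> real (n div p)"
      using p by (simp add: field_simps)
  qed
  also have "\<dots> \<le> (\<Sum>d=1..n. mangoldt d * real (n div d))"
    by (intro sum_mono2) (auto simp: mangoldt_nonneg Suc_le_eq prime_gt_0_nat)
  also have "\<dots> \<le> real n * ln (real n)"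
    using ln_fact_le ln_fact_eq_sum_mangoldt by metis
  also have "(\<Sum>p | prime p \<and> p \<le> n. mangoldt p * (real n / (2 * real p))) =
      real n * ((\<Sum>p | prime p \<and> p \<le> n. ln (real p) / real p) / 2)"
    by (simp add: sum_distrib_left sum_divide_distrib mult_ac)
  finally show ?thesis using False by simp
qed

section \<open>Chebyshev's lower bound for the number of primes, and prime divisors\<close>

lemma ln_4_ge: "1 \<le> ln (4 :: real)"
proof -
  have "exp 1 \<le> (4 :: real)" using exp_le by simp
  then have "ln (exp 1) \<le> ln (4 :: real)" by (subst ln_le_cancel_iff) auto
  then show ?thesis by simp
qed

text \<open>Chebyshev's argument: the central binomial coefficient is at least
  \<open>4 ^ n / (2 * n)\<close>, while each prime \<open>p \<le> 2 * n\<close> contributes to its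
  logarithm at most \<open>ln p\<close> for every power of \<open>p\<close> up to
  \<open>2 * n\<close>, hence at most \<open>ln (2 * n)\<close> in total.\<close>

lemma chebyshev_lower_even:
  assumes "n > 0"
  shows "real n * ln 4 - ln (2 * real n) \<le> real (card {p. prime p \<and> p \<le> 2 * n}) * ln (2 * real n)"
proof -
  have "(4 :: real) ^ n / (2 * real n) \<le> fact (2 * n) / (fact n * fact n)"
    using central_binomial_lower_bound[OF assms] by (simp add: binomial_fact)
  then have "ln ((4 :: real) ^ n / (2 * real n)) \<le> ln (fact (2 * n) / (fact n * fact n))"
    using assms by (subst ln_le_cancel_iff) auto
  then have "real n * ln 4 - ln (2 * real n) \<le> ln (fact (2 * n)) - 2 * ln (fact n :: real)"
    using assms by (simp add: ln_div ln_mult ln_realpow)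
  \<comment> \<open>The range can be extended to \<open>2 * n\<close> because
    \<open>n div d = 0\<close> for \<open>d > n\<close>; both factorials then have the same
    range.\<close>
  also have "ln (fact n :: real) = (\<Sum>d=1..2*n. mangoldt d * real (n div d))"
    unfolding ln_fact_eq_sum_mangoldt by (rule sum.mono_neutral_left) auto
  also have "ln (fact (2 * n)) - 2 * (\<Sum>d=1..2*n. mangoldt d * real (n div d)) =
      (\<Sum>d=1..2*n. mangoldt d * (real (2 * n div d) - 2 * real (n div d)))"
    unfolding ln_fact_eq_sum_mangoldt
    by (simp add: sum_distrib_left sum_subtractf algebra_simps)
  also have "\<dots> \<le> (\<Sum>d=1..2*n. mangoldt d * 1)"
  proof (intro sum_mono mult_left_mono mangoldt_nonneg)
    fix d assume "d \<in> {1..2 * n}"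
    then have d: "d > 0" by simp
    have "2 * n < d * (2 * (n div d) + 2)"
      using dividend_less_times_div[OF d, of n] by (simp add: algebra_simps)
    then have "2 * n div d < 2 * (n div d) + 2"
      using d by (simp add: div_less_iff_less_mult mult.commute)
    then show "real (2 * n div d) - 2 * real (n div d) \<le> 1" by linarith
  qed
  also have "\<dots> = (\<Sum>p | prime p \<and> p \<le> 2 * n. ln (real p) * (\<Sum>k | p ^ Suc k \<le> 2 * n. 1))"
    by (rule sum_mangoldt_eq_sum_primes)
  also have "\<dots> \<le> (\<Sum>p | prime p \<and> p \<le> 2 * n. ln (2 * real n))"
  proof (intro sum_mono)
    fix p assume "p \<in> {p. prime p \<and> p \<le> 2 * n}"
    then have p: "prime p" by simp
    have p1: "1 < real p" using prime_gt_1_nat[OF p] by simp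
    define K where "K = {k. p ^ Suc k \<le> 2 * n}"
    have bd: "real (Suc k) \<le> ln (2 * real n) / ln (real p)" if "k \<in> K" for k
    proof -
      have "real (p ^ Suc k) \<le> real (2 * n)"
        using that unfolding K_def of_nat_le_iff by simp
      then have "ln (real p ^ Suc k) \<le> ln (2 * real n)"
        using p1 by (subst ln_le_cancel_iff) (auto simp: assms)
      then have "real (Suc k) * ln (real p) \<le> ln (2 * real n)"
        using p1 by (subst (asm) ln_realpow) auto
      then show ?thesis using p1 by (simp add: field_simps)
    qed
    have "K \<subseteq> {..<nat \<lfloor>ln (2 * real n) / ln (real p)\<rfloor>}"
      using bd by (fastforce simp: le_nat_iff le_floor_iff less_eq_Suc_le)
    then have "card K \<le> nat \<lfloor>ln (2 * real n) / ln (real p)\<rfloor>"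
      using card_mono[of "{..<nat \<lfloor>ln (2 * real n) / ln (real p)\<rfloor>}" K] by simp
    also have "real (nat \<lfloor>ln (2 * real n) / ln (real p)\<rfloor>) \<le> ln (2 * real n) / ln (real p)"
      using p1 assms by (intro of_nat_floor) simp
    finally have "real (card K) \<le> ln (2 * real n) / ln (real p)" by simp
    then show "ln (real p) * (\<Sum>k | p ^ Suc k \<le> 2 * n. 1) \<le> ln (2 * real n)"
      using p1 by (simp add: K_def field_simps)
  qed
  finally show ?thesis by simp
qed

lemma finite_primes_le: "finite {p. prime p \<and> real p \<le> X}"
  by (rule finite_subset[of _ "{..nat \<lfloor>X\<rfloor>}"]) (auto simp: le_nat_iff le_floor_iff nat_le_iff)

lemma chebyshev_lower:
  assumes "X \<ge> 2"
  shows "X / 2 - 2 - ln X \<le> real (card {p. prime p \<and> real p \<le> X}) * ln X"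
proof -
  define n where "n = nat \<lfloor>X / 2\<rfloor>"
  have n: "real n \<le> X / 2" "X / 2 - 1 < real n" "n > 0"
    using assms by (auto simp: n_def of_nat_floor) (linarith+)?
  have mono: "ln (2 * real n) \<le> ln X"
    using n by simp
  have "X / 2 - 2 - ln X \<le> real n * 1 - ln (2 * real n)"
    using n mono by linarith
  also have "\<dots> \<le> real n * ln 4 - ln (2 * real n)"
    using ln_4_ge by (intro diff_right_mono mult_left_mono) auto
  also have "\<dots> \<le> real (card {p. prime p \<and> p \<le> 2 * n}) * ln (2 * real n)"
    by (rule chebyshev_lower_even) fact
  also have "\<dots> \<le> real (card {p. prime p \<and> real p \<le> X}) * ln X"
  proof (intro mult_mono mono)
    show "real (card {p. prime p \<and> p \<le> 2 * n}) \<le> real (card {p. prime p \<and> real p \<le> X})"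
      using n finite_primes_le[of X] by (intro of_nat_mono card_mono) auto
  qed (use n in auto)
  finally show ?thesis .
qed

text \<open>Each prime factor contributes at least 2 to \<open>q\<close>, so 2 to their number is at
  most \<open>q\<close>; then \<open>ln 2 \<ge> 1 / 2\<close>.\<close>

lemma card_prime_divisors_le:
  assumes "q > 0"
  shows "real (card {p. prime p \<and> p dvd q}) \<le> 2 * ln (real q)"
proof -
  have eq: "{p. prime p \<and> p dvd q} = prime_factors q"
    using assms by (auto simp: prime_factors_dvd)
  have "(\<Prod>p\<in>prime_factors q. 2) \<le> (\<Prod>p\<in>prime_factors q. p ^ multiplicity p q)"
  proof (intro prod_mono conjI)
    fix p assume p: "p \<in> prime_factors q"
    then have "multiplicity p q > 0" "p \<ge> 2"
      using prime_ge_2_nat by (auto simp: prime_factors_multiplicity)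
    then show "2 \<le> p ^ multiplicity p q"
      using self_le_power[of p "multiplicity p q"] by linarith
  qed simp
  also have "\<dots> = q"
    using prime_factorization_nat[OF assms] by simp
  finally have "real (2 ^ card (prime_factors q)) \<le> real q"
    by (intro of_nat_mono) simp
  then have "ln (2 ^ card (prime_factors q)) \<le> ln (real q)"
    using assms by (subst ln_le_cancel_iff) auto
  then have "real (card (prime_factors q)) * ln 2 \<le> ln (real q)"
    by (simp add: ln_realpow)
  moreover have "1 / 2 \<le> ln (2::real)"
    using ln_4_ge ln_realpow[of 2 2] by simp
  then have "real (card (prime_factors q)) * (1 / 2) \<le> real (card (prime_factors q)) * ln 2"
    by (intro mult_left_mono) auto
  ultimately show ?thesis by (simp add: eq)
qed

section \<open>Products of distinct primes\<close>

text \<open>The elementary symmetric polynomial of degree \<open>n\<close> in the numbers 1/p for p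
  in \<open>P\<close>. For a set of primes it is also the sum of 1/a over the products a of
  \<open>n\<close> distinct members.\<close>

definition esym :: "nat set \<Rightarrow> nat \<Rightarrow> real" where
  "esym P n = (\<Sum>s | s \<subseteq> P \<and> card s = n. 1 / real (\<Prod>s))"

declare of_nat_prod [simp del]

lemma esym_nonneg: "esym P n \<ge> 0"
  by (auto simp: esym_def intro!: sum_nonneg)

text \<open>Count pairs of an \<open>n\<close>-subset \<open>s\<close> and a new element
  \<open>p\<close> by \<open>insert p s\<close>: each set of size \<open>Suc n\<close> arises
  \<open>Suc n\<close> times. Forbidding \<open>p \<in> s\<close> removes at most
  \<open>n / w\<close> from the sum of reciprocals.\<close>

lemma esym_Suc_ge:
  assumes P: "finite P" "\<And>p. p \<in> P \<Longrightarrow> w \<le> real p" and w: "w > 0"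
  shows "esym P n * ((\<Sum>p\<in>P. 1 / real p) - real n / w) \<le> real (Suc n) * esym P (Suc n)"
proof -
  define S where "S n = {s. s \<subseteq> P \<and> card s = n}" for n
  have finS: "finite (S n)" for n using P(1) by (simp add: S_def)
  have fin: "finite s" if "s \<in> S n" for s n
    using that P(1) by (auto simp: S_def intro: finite_subset)
  have "esym P n * ((\<Sum>p\<in>P. 1 / real p) - real n / w) =
      (\<Sum>s\<in>S n. 1 / real (\<Prod>s) * ((\<Sum>p\<in>P. 1 / real p) - real n / w))"
    by (simp add: esym_def S_def sum_distrib_right)
  also have "\<dots> \<le> (\<Sum>s\<in>S n. 1 / real (\<Prod>s) * (\<Sum>p\<in>P - s. 1 / real p))"
  proof (intro sum_mono mult_left_mono)
    fix s assume s: "s \<in> S n"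
    have "(\<Sum>p\<in>s. 1 / real p) \<le> (\<Sum>p\<in>s. 1 / w)"
    proof (intro sum_mono)
      fix p assume "p \<in> s"
      then have "w \<le> real p" using s P(2) by (auto simp: S_def)
      then show "1 / real p \<le> 1 / w" using w by (intro divide_left_mono) auto
    qed
    also have "\<dots> = real n / w"
      using s by (simp add: S_def)
    finally show "(\<Sum>p\<in>P. 1 / real p) - real n / w \<le> (\<Sum>p\<in>P - s. 1 / real p)"
      using sum_diff[of P s "\<lambda>p. 1 / real p"] P(1) s by (simp add: S_def)
  qed simp
  also have "\<dots> = (\<Sum>(s,p)\<in>(SIGMA s:S n. P - s). 1 / real (\<Prod>s) * (1 / real p))"
    using P(1) finS by (simp add: sum_distrib_left sum.Sigma)
  also have "\<dots> = (\<Sum>(t,p)\<in>(SIGMA t:S (Suc n). t). 1 / real (\<Prod>t))"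
  proof (rule sum.reindex_bij_witness[of _ "\<lambda>(t,p). (t - {p}, p)" "\<lambda>(s,p). (insert p s, p)"])
    fix x assume x: "x \<in> (SIGMA s:S n. P - s)"
    obtain s p where sp: "x = (s, p)" by force
    with x have s: "s \<in> S n" "p \<in> P" "p \<notin> s" by auto
    have f: "finite s" using fin s by blast
    show "(case case x of (s,p) \<Rightarrow> (insert p s, p) of (t,p) \<Rightarrow> (t - {p}, p)) = x"
      using s by (simp add: sp)
    show "(case x of (s,p) \<Rightarrow> (insert p s, p)) \<in> (SIGMA t:S (Suc n). t)"
      using s f by (simp add: sp S_def)
    show "(case case x of (s,p) \<Rightarrow> (insert p s, p) of (t,p) \<Rightarrow> 1 / real (\<Prod>t)) =
        (case x of (s,p) \<Rightarrow> 1 / real (\<Prod>s) * (1 / real p))"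
      using s f by (simp add: sp)
  next
    fix y assume y: "y \<in> (SIGMA t:S (Suc n). t)"
    obtain t p where tp: "y = (t, p)" by force
    with y have t: "t \<in> S (Suc n)" "p \<in> t" by auto
    have f: "finite t" using fin t by blast
    show "(case case y of (t,p) \<Rightarrow> (t - {p}, p) of (s,p) \<Rightarrow> (insert p s, p)) = y"
      using t by (auto simp: tp)
    show "(case y of (t,p) \<Rightarrow> (t - {p}, p)) \<in> (SIGMA s:S n. P - s)"
      using t f by (auto simp: tp S_def)
  qed
  also have "\<dots> = (\<Sum>t\<in>S (Suc n). \<Sum>p\<in>t. 1 / real (\<Prod>t))"
    using fin finS by (subst sum.Sigma) auto
  also have "\<dots> = real (Suc n) * esym P (Suc n)"
    unfolding esym_def S_def[symmetric] sum_distrib_left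
    by (intro sum.cong refl) (simp add: S_def)
  finally show ?thesis .
qed

text \<open>Iterates the previous step \<open>j\<close> times. The condition
  \<open>2 * n \<le> \<sigma> * w\<close> keeps the correction below half of
  \<open>\<sigma>\<close>, and every divisor \<open>Suc (J + j)\<close> met on the way is at most
  \<open>n\<close>.\<close>

lemma esym_add_ge:
  assumes P: "finite P" "\<And>p. p \<in> P \<Longrightarrow> w \<le> real p" and w: "w > 0"
    and n: "J + j \<le> n" "n > 0" "2 * real n \<le> (\<Sum>p\<in>P. 1 / real p) * w"
  shows "esym P J * ((\<Sum>p\<in>P. 1 / real p) / (2 * real n)) ^ j \<le> esym P (J + j)"
  using n(1)
proof (induction j)
  case (Suc j)
  define \<sigma> where "\<sigma> = (\<Sum>p\<in>P. 1 / real p)"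
  have \<sigma>: "\<sigma> \<ge> 0" by (auto simp: \<sigma>_def intro!: sum_nonneg)
  have "esym P J * (\<sigma> / (2 * real n)) ^ Suc j = esym P J * (\<sigma> / (2 * real n)) ^ j * (\<sigma> / 2) / real n"
    by simp
  also have "\<dots> \<le> esym P (J + j) * (\<sigma> / 2) / real n"
    using Suc \<sigma> by (intro divide_right_mono mult_right_mono) (auto simp: \<sigma>_def)
  also have "\<dots> \<le> esym P (J + j) * (\<sigma> - real (J + j) / w) / real n"
  proof (intro divide_right_mono mult_left_mono esym_nonneg)
    have "2 * real (J + j) \<le> \<sigma> * w"
      using Suc.prems n(3) by (simp add: \<sigma>_def)
    then have "real (J + j) / w \<le> \<sigma> / 2"
      using w by (simp add: field_simps)
    then show "\<sigma> / 2 \<le> \<sigma> - real (J + j) / w" by simp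
  qed simp
  also have "\<dots> \<le> real (Suc (J + j)) * esym P (Suc (J + j)) / real n"
    using esym_Suc_ge[OF P w, of "J + j"] by (intro divide_right_mono) (auto simp: \<sigma>_def)
  also have "\<dots> \<le> real n * esym P (Suc (J + j)) / real n"
    using Suc.prems by (intro divide_right_mono mult_right_mono esym_nonneg) auto
  finally show ?case using n(2) by (simp add: \<sigma>_def)
qed simp

section \<open>Integers represented through sets of primes, and the resonator built on them\<close>

lemma prime_dvd_prod_primes_iff:
  fixes s :: "nat set"
  assumes "finite s" "\<And>p. p \<in> s \<Longrightarrow> prime p" "prime p"
  shows "p dvd \<Prod>s \<longleftrightarrow> p \<in> s"
  using prime_dvd_prod_iff[OF assms(1,3), of "\<lambda>x. x"] assms(2,3) primes_dvd_imp_eq[of p] dvd_refl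
  by (metis (no_types))

lemma prod_primes_pos:
  fixes s :: "nat set"
  assumes "\<And>p. p \<in> s \<Longrightarrow> prime p"
  shows "\<Prod>s > 0"
  using assms by (intro prod_pos) (auto simp: prime_gt_0_nat)

lemma inj_on_prod_primes:
  fixes P :: "nat set"
  assumes "finite P" "\<And>p. p \<in> P \<Longrightarrow> prime p"
  shows "inj_on (\<lambda>s. \<Prod>s) {s. s \<subseteq> P}"
proof (rule inj_onI)
  fix s t assume st: "s \<in> {s. s \<subseteq> P}" "t \<in> {s. s \<subseteq> P}" "\<Prod>s = \<Prod>t"
  have "p \<in> s \<longleftrightarrow> p \<in> t" if "p \<in> P" for p
    using prime_dvd_prod_primes_iff[of s p] prime_dvd_prod_primes_iff[of t p] st assms that
    by (metis finite_subset mem_Collect_eq subsetD)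
  with st show "s = t" by blast
qed

text \<open>Every integer \<open>c = h \<cdot> \<Prod>s\<close> has the representations \<open>c = (h \<cdot> \<Prod>b) \<cdot> \<Prod>(s - b)\<close>; pairing
  \<open>\<nu>\<close> with the weight \<open>1 / sqrt c\<close> in the Cauchy-Schwarz inequality loses only the factor
  \<open>\<Sum>h. 1 / h\<close>.\<close>

lemma sum_square_representations_ge:
  fixes P H :: "nat set" and J j :: nat and x c\<^sub>1 :: real
  defines "n \<equiv> J + j"
  defines "A \<equiv> (\<lambda>a. \<Prod>a) ` {a. a \<subseteq> P \<and> card a = J}"
  defines "C \<equiv> (\<lambda>(h, s). h * \<Prod>s) ` (H \<times> {s. s \<subseteq> P \<and> card s = n})"
  defines "M \<equiv> {m. 1 \<le> m \<and> real m \<le> x}"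
  assumes P: "finite P" "\<And>p. p \<in> P \<Longrightarrow> prime p"
    and H: "finite H" "\<And>h. h \<in> H \<Longrightarrow> h > 0" "\<And>h p. h \<in> H \<Longrightarrow> p \<in> P \<Longrightarrow> \<not> p dvd h"
    and x: "x \<ge> 0" and c1: "c\<^sub>1 \<ge> 0"
      "\<And>b. b \<subseteq> P \<Longrightarrow> card b = j \<Longrightarrow>
        c\<^sub>1 * sqrt (x / real (\<Prod>b)) \<le> (\<Sum>h | h \<in> H \<and> real (h * \<Prod>b) \<le> x. 1 / sqrt (real h))"
  shows "c\<^sub>1 ^ 2 * x * real (n choose j) ^ 2 * esym P n \<le>
    (\<Sum>c\<in>C. (\<Sum>(m, a)\<in>{(m, a)\<in>M \<times> A. m * a = c}. 1 / sqrt (real a)) ^ 2) * (\<Sum>h\<in>H. 1 / real h)"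
proof -
  define S where "S = {s. s \<subseteq> P \<and> card s = n}"
  define \<nu> where "\<nu> c = (\<Sum>(m, a)\<in>{(m, a)\<in>M \<times> A. m * a = c}. 1 / sqrt (real a))" for c
  define B where "B s = {b. b \<subseteq> s \<and> card b = j}" for s :: "nat set"
  define t where "t h s = 1 / sqrt (real h * real (\<Prod>s))" for h s
  have finS: "finite S" using P(1) by (simp add: S_def)
  have finM: "finite M"
    by (rule finite_subset[of _ "{..nat \<lfloor>x\<rfloor>}"]) (auto simp: M_def le_nat_iff le_floor_iff)
  have finA: "finite A" using P(1) by (simp add: A_def)
  have sub: "s \<subseteq> P" "finite s" if "s \<in> S" for s
    using that P(1) by (auto simp: S_def intro: finite_subset)
  have finB: "finite (B s)" if "s \<in> S" for s
    using sub(2)[OF that] by (simp add: B_def)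
  have pos: "\<Prod>s > 0" if "s \<subseteq> P" for s
    using that P(2) by (intro prod_primes_pos) auto
  \<comment> \<open>No prime of \<open>P\<close> divides \<open>h\<close>, so \<open>s\<close> is
    recovered from \<open>h * \<Prod>s\<close> as the set of its divisors in \<open>P\<close>, and
    then \<open>h\<close> by cancellation.\<close>
  have inj: "inj_on (\<lambda>(h, s). h * \<Prod>s) (H \<times> S)"
  proof (rule inj_onI, clarify)
    fix h s h' s' assume *: "h \<in> H" "s \<in> S" "h' \<in> H" "s' \<in> S" "h * \<Prod>s = h' * \<Prod>s'"
    have dvd: "p dvd h * \<Prod>s \<longleftrightarrow> p \<in> s" if "h \<in> H" "s \<in> S" "p \<in> P" for h s p
      using that H(3) P(2) sub prime_dvd_prod_primes_iff[of s p] prime_dvd_mult_iff[of p h "\<Prod>s"]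
      by blast
    have "p \<in> s \<longleftrightarrow> p \<in> s'" if "p \<in> P" for p
      using dvd[OF *(1,2) that] dvd[OF *(3,4) that] *(5) by simp
    then have "s = s'" using sub(1) *(2,4) by blast
    with * pos[OF sub(1)[OF *(2)]] show "h = h' \<and> s = s'" by simp
  qed
  have \<nu>_ge: "(\<Sum>b | b \<in> B s \<and> real (h * \<Prod>b) \<le> x. 1 / sqrt (real (\<Prod>(s - b)))) \<le> \<nu> (h * \<Prod>s)"
    if "h \<in> H" "s \<in> S" for h s
  proof -
    define B' where "B' = {b. b \<in> B s \<and> real (h * \<Prod>b) \<le> x}"
    have split: "\<Prod>b * \<Prod>(s - b) = \<Prod>s" if "b \<in> B'" for b
      using prod.subset_diff[of b s "\<lambda>x. x"] that sub(2)[OF \<open>s \<in> S\<close>]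
      by (simp add: B'_def B_def mult.commute)
    have injb: "inj_on (\<lambda>b. (h * \<Prod>b, \<Prod>(s - b))) B'"
    proof (rule inj_onI)
      fix b b' assume b: "b \<in> B'" "b' \<in> B'" "(h * \<Prod>b, \<Prod>(s - b)) = (h * \<Prod>b', \<Prod>(s - b'))"
      then have "\<Prod>b = \<Prod>b'" using H(2)[OF that(1)] by simp
      moreover have "b \<subseteq> P" "b' \<subseteq> P" using b sub(1)[OF that(2)] by (auto simp: B'_def B_def)
      ultimately show "b = b'" using inj_on_prod_primes[OF P] by (auto dest: inj_onD)
    qed
    have "(\<Sum>b\<in>B'. 1 / sqrt (real (\<Prod>(s - b)))) =
        (\<Sum>(m, a)\<in>(\<lambda>b. (h * \<Prod>b, \<Prod>(s - b))) ` B'. 1 / sqrt (real a))"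
      by (subst sum.reindex[OF injb]) simp
    also have "\<dots> \<le> \<nu> (h * \<Prod>s)"
      unfolding \<nu>_def
    proof (rule sum_mono2)
      show "finite {(m, a)\<in>M \<times> A. m * a = h * \<Prod>s}"
        by (rule finite_subset[of _ "M \<times> A"]) (use finM finA in auto)
      show "(\<lambda>b. (h * \<Prod>b, \<Prod>(s - b))) ` B' \<subseteq> {(m, a)\<in>M \<times> A. m * a = h * \<Prod>s}"
      proof (rule image_subsetI)
        fix b assume b: "b \<in> B'"
        then have bs: "b \<subseteq> s" "card b = j" "real (h * \<Prod>b) \<le> x" by (auto simp: B'_def B_def)
        have "h * \<Prod>b > 0"
          using pos[of b] bs sub(1)[OF that(2)] H(2)[OF that(1)] by auto
        then have "h * \<Prod>b \<in> M" using bs by (simp add: M_def Suc_le_eq)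
        moreover have "card (s - b) = J"
          using bs that(2) finite_subset[OF bs(1) sub(2)[OF that(2)]]
          by (simp add: card_Diff_subset S_def n_def)
        then have "\<Prod>(s - b) \<in> A"
          unfolding A_def using sub(1)[OF that(2)] by blast
        ultimately show "(h * \<Prod>b, \<Prod>(s - b)) \<in> {(m, a)\<in>M \<times> A. m * a = h * \<Prod>s}"
          using split[OF b] by (simp add: mult.assoc)
      qed
    qed auto
    finally show ?thesis by (simp add: B'_def)
  qed
  have "c\<^sub>1 * sqrt x * (real (n choose j) * esym P n) = (\<Sum>s\<in>S. \<Sum>b\<in>B s. c\<^sub>1 * sqrt x / real (\<Prod>s))"
    unfolding esym_def S_def[symmetric] sum_distrib_left
  proof (intro sum.cong refl)
    fix s assume "s \<in> S"
    then have "card (B s) = n choose j"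
      using n_subsets[OF sub(2), of s j] by (simp add: B_def S_def)
    then show "c\<^sub>1 * sqrt x * (real (n choose j) * (1 / real (\<Prod>s))) = (\<Sum>b\<in>B s. c\<^sub>1 * sqrt x / real (\<Prod>s))"
      by simp
  qed
  also have "\<dots> \<le> (\<Sum>s\<in>S. \<Sum>b\<in>B s. \<Sum>h | h \<in> H \<and> real (h * \<Prod>b) \<le> x. t h s * (1 / sqrt (real (\<Prod>(s - b)))))"
  proof (intro sum_mono)
    fix s b assume s: "s \<in> S" and "b \<in> B s"
    then have b: "b \<subseteq> s" "card b = j" "b \<subseteq> P" using sub(1) by (auto simp: B_def)
    have split: "real (\<Prod>s) = real (\<Prod>b) * real (\<Prod>(s - b))"
      using prod.subset_diff[of b s "\<lambda>x. x"] b(1) sub(2)[OF s] by (simp add: mult.commute)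
    have posb: "real (\<Prod>b) > 0" "real (\<Prod>(s - b)) > 0"
      using pos[of b] pos[of "s - b"] b(3) sub(1)[OF s] by auto
    \<comment> \<open>Since \<Prod>s = \<Prod>b * \<Prod>(s - b), the three square roots combine to
      a quantity independent of \<open>b\<close>. This is why the weight \<open>1 / sqrt a\<close>
      is paired with \<open>t h s\<close>.\<close>
    have "c\<^sub>1 * sqrt x / real (\<Prod>s) =
        1 / sqrt (real (\<Prod>s)) * (1 / sqrt (real (\<Prod>(s - b)))) * (c\<^sub>1 * sqrt (x / real (\<Prod>b)))"
      unfolding split using posb
      by (simp add: real_sqrt_mult real_sqrt_divide field_simps)
    also have "\<dots> \<le> 1 / sqrt (real (\<Prod>s)) * (1 / sqrt (real (\<Prod>(s - b)))) *
        (\<Sum>h | h \<in> H \<and> real (h * \<Prod>b) \<le> x. 1 / sqrt (real h))"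
      by (intro mult_left_mono c1 b) simp_all
    also have "\<dots> = (\<Sum>h | h \<in> H \<and> real (h * \<Prod>b) \<le> x. t h s * (1 / sqrt (real (\<Prod>(s - b)))))"
      by (simp add: t_def sum_distrib_left real_sqrt_mult mult_ac)
    finally show "c\<^sub>1 * sqrt x / real (\<Prod>s) \<le>
        (\<Sum>h | h \<in> H \<and> real (h * \<Prod>b) \<le> x. t h s * (1 / sqrt (real (\<Prod>(s - b)))))" .
  qed
  also have "\<dots> = (\<Sum>s\<in>S. \<Sum>h\<in>H. \<Sum>b | b \<in> B s \<and> real (h * \<Prod>b) \<le> x. t h s * (1 / sqrt (real (\<Prod>(s - b)))))"
    by (intro sum.cong refl sum.swap_restrict finB H)
  also have "\<dots> \<le> (\<Sum>s\<in>S. \<Sum>h\<in>H. t h s * \<nu> (h * \<Prod>s))"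
    unfolding sum_distrib_left[symmetric]
    by (intro sum_mono mult_left_mono \<nu>_ge) (auto simp: t_def)
  also have "\<dots> = (\<Sum>(h,s)\<in>H \<times> S. t h s * \<nu> (h * \<Prod>s))"
    by (subst sum.swap) (simp add: sum.cartesian_product)
  finally have "c\<^sub>1 * sqrt x * (real (n choose j) * esym P n) \<le> (\<Sum>(h,s)\<in>H \<times> S. t h s * \<nu> (h * \<Prod>s))" .
  then have "(c\<^sub>1 * sqrt x * (real (n choose j) * esym P n)) ^ 2 \<le> (\<Sum>(h,s)\<in>H \<times> S. t h s * \<nu> (h * \<Prod>s)) ^ 2"
    using c1(1) x esym_nonneg by (intro power_mono) auto
  also have "\<dots> \<le> (\<Sum>(h,s)\<in>H \<times> S. t h s ^ 2) * (\<Sum>(h,s)\<in>H \<times> S. \<nu> (h * \<Prod>s) ^ 2)"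
    using Cauchy_Schwarz_ineq_sum[of "\<lambda>(h,s). t h s" "\<lambda>(h,s). \<nu> (h * \<Prod>s)" "H \<times> S"]
    by (simp add: case_prod_unfold)
  also have "(\<Sum>(h,s)\<in>H \<times> S. \<nu> (h * \<Prod>s) ^ 2) = (\<Sum>c\<in>C. \<nu> c ^ 2)"
    unfolding C_def S_def[symmetric] by (subst sum.reindex[OF inj]) (simp add: case_prod_unfold)
  also have "(\<Sum>(h,s)\<in>H \<times> S. t h s ^ 2) = (\<Sum>h\<in>H. 1 / real h) * esym P n"
    unfolding esym_def S_def[symmetric] sum_product sum.cartesian_product t_def
    by (simp add: power_divide)
  \<comment> \<open>The left side carries \<open>esym P n\<close> squared, and the sum of
    \<open>t h s ^ 2\<close> supplies one factor on the right, so a single factor remains after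
    cancelling.\<close>
  finally have *: "(c\<^sub>1 ^ 2 * x * real (n choose j) ^ 2 * esym P n) * esym P n \<le>
      ((\<Sum>c\<in>C. \<nu> c ^ 2) * (\<Sum>h\<in>H. 1 / real h)) * esym P n"
    using real_sqrt_pow2[OF x] by (simp add: power_mult_distrib) (simp add: power2_eq_square mult_ac)
  show ?thesis
  proof (cases "esym P n = 0")
    case True
    then show ?thesis by (auto intro!: mult_nonneg_nonneg sum_nonneg)
  next
    case False
    then have "esym P n > 0" using esym_nonneg[of P n] by simp
    with * show ?thesis by (simp add: \<nu>_def)
  qed
qed

lemma sum_inverse_products:
  assumes "finite P" "\<And>p. p \<in> P \<Longrightarrow> prime p"
  shows "(\<Sum>a\<in>(\<lambda>a. \<Prod>a) ` {a. a \<subseteq> P \<and> card a = J}. (1 / sqrt (real a)) ^ 2) = esym P J"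
proof -
  have "inj_on (\<lambda>a. \<Prod>a) {a. a \<subseteq> P \<and> card a = J}"
    by (rule inj_on_subset[OF inj_on_prod_primes[OF assms]]) auto
  then show ?thesis
    by (simp add: sum.reindex esym_def power_divide)
qed

lemma finite_prime_divisors: "q > 0 \<Longrightarrow> finite {p::nat. prime p \<and> p dvd q}"
  by (rule finite_subset[of _ "{..q}"]) (auto dest: dvd_imp_le)

text \<open>The sum of \<open>r(a)^2\<close> is \<open>esym P J\<close>. With
  \<open>n = J + j\<close>, the representation bound is divided by it using
  \<open>n choose j \<ge> (n / j) ^ j\<close> and
  \<open>esym P n / esym P J \<ge> (\<sigma> / (2 * n)) ^ j\<close>; since the binomial enters
  squared, the gain is \<open>(n * \<sigma> / (2 * j ^ 2)) ^ j\<close>. The bound \<open>Y\<close>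
  serves twice: it puts \<open>A\<close> below \<open>q\<close>, and it bounds the size of
  \<open>A\<close>.\<close>

lemma large_character_sum_of_resonator:
  fixes P H :: "nat set" and J j q :: nat and x c\<^sub>1 w Y V h\<^sub>0 :: real
  defines "\<sigma> \<equiv> (\<Sum>p\<in>P. 1 / real p)"
  assumes q: "q > 0"
    and P: "finite P" "\<And>p. p \<in> P \<Longrightarrow> prime p" "\<And>p. p \<in> P \<Longrightarrow> \<not> p dvd q" "\<And>p. p \<in> P \<Longrightarrow> w \<le> real p"
    and w: "w > 0" and j: "j > 0" "2 * real (J + j) \<le> \<sigma> * w"
    and H: "finite H" "\<And>h. h \<in> H \<Longrightarrow> h > 0" "\<And>h. h \<in> H \<Longrightarrow> coprime h q"
      "\<And>h p. h \<in> H \<Longrightarrow> p \<in> P \<Longrightarrow> \<not> p dvd h"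
    and h0: "(\<Sum>h\<in>H. 1 / real h) \<le> h\<^sub>0"
    and Y: "\<And>a. a \<subseteq> P \<Longrightarrow> card a = J \<Longrightarrow> real (\<Prod>a) \<le> Y" "Y < real q"
    and x: "x \<ge> 0" and c1: "c\<^sub>1 \<ge> 0"
      "\<And>b. b \<subseteq> P \<Longrightarrow> card b = j \<Longrightarrow>
        c\<^sub>1 * sqrt (x / real (\<Prod>b)) \<le> (\<Sum>h | h \<in> H \<and> real (h * \<Prod>b) \<le> x. 1 / sqrt (real h))"
    and V: "V \<ge> 0"
      "(V + x ^ 2 * Y / real (card (characters q))) * h\<^sub>0 <
        c\<^sub>1 ^ 2 * x * (real (J + j) * \<sigma> / (2 * real j ^ 2)) ^ j"
  shows "\<exists>\<chi>. dirichlet_character q \<chi> \<and> \<chi> \<noteq> principal_character q \<and>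
    norm (character_sum \<chi> x) ^ 2 > V"
proof -
  define n where "n = J + j"
  define A where "A = (\<lambda>a. \<Prod>a) ` {a. a \<subseteq> P \<and> card a = J}"
  define C where "C = (\<lambda>(h, s). h * \<Prod>s) ` (H \<times> {s. s \<subseteq> P \<and> card s = n})"
  define M where "M = {m. 1 \<le> m \<and> real m \<le> x}"
  define T where "T = (\<Sum>c\<in>C. (\<Sum>(m, a)\<in>{(m, a)\<in>M \<times> A. m * a = c}. 1 / sqrt (real a)) ^ 2)"
  define h\<^sub>1 where "h\<^sub>1 = (\<Sum>h\<in>H. 1 / real h)"
  define E where "E = V + x ^ 2 * Y / real (card (characters q))"
  have finM: "finite M" and cardM: "real (card M) \<le> x"
  proof -
    have sub: "M \<subseteq> {1..nat \<lfloor>x\<rfloor>}" by (auto simp: M_def le_nat_iff le_floor_iff)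
    then show "finite M" by (rule finite_subset) simp
    have "card M \<le> nat \<lfloor>x\<rfloor>" using card_mono[OF _ sub] by simp
    then have "real (card M) \<le> real (nat \<lfloor>x\<rfloor>)" by simp
    also have "\<dots> \<le> x" using x by (rule of_nat_floor)
    finally show "real (card M) \<le> x" .
  qed
  have pos: "\<Prod>s > 0" if "s \<subseteq> P" for s
    using that P(2) by (intro prod_primes_pos) auto
  have cop: "coprime (\<Prod>s) q" if "s \<subseteq> P" for s
    by (rule prod_coprime_left) (meson P(2,3) prime_imp_coprime subsetD that)
  have finA: "finite A" using P(1) by (simp add: A_def)
  have finC: "finite C" using P(1) H(1) by (auto simp: C_def)
  have \<sigma>: "\<sigma> > 0"
    using j w by (smt (verit) of_nat_0_less_iff add_gr_0 zero_less_mult_pos2 mult_pos_pos)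
  have n: "n > 0" "2 * real n \<le> \<sigma> * w" using j by (auto simp: n_def)
  \<comment> \<open>Climbing from \<open>esym P 0 = 1\<close>. Positivity allows the division by
    \<open>esym P J\<close> and shows that \<open>P\<close> has subsets of size
    \<open>J\<close>.\<close>
  have eJ: "esym P J > 0"
  proof -
    have "esym P 0 = 1"
      using P(1) by (simp add: esym_def finite_subset cong: conj_cong)
    moreover have "esym P 0 * (\<sigma> / (2 * real n)) ^ J \<le> esym P (0 + J)"
      using n(2) unfolding \<sigma>_def by (intro esym_add_ge[OF P(1,4) w]) (use n in \<open>auto simp: n_def\<close>)
    moreover have "(\<sigma> / (2 * real n)) ^ J > 0" using \<sigma> n by simp
    ultimately show ?thesis by simp
  qed
  have cardA: "real (card A) \<le> Y"
  proof -
    have sub: "A \<subseteq> {1..nat \<lfloor>Y\<rfloor>}"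
      using pos Y(1) by (auto simp: A_def Suc_le_eq intro!: le_nat_floor)
    have "{a. a \<subseteq> P \<and> card a = J} \<noteq> {}"
    proof
      assume "{a. a \<subseteq> P \<and> card a = J} = {}"
      then have "esym P J = 0" by (simp only: esym_def sum.empty)
      with eJ show False by simp
    qed
    then have "A \<noteq> {}" by (simp add: A_def)
    then have "nat \<lfloor>Y\<rfloor> \<ge> 1" using sub by fastforce
    then have "Y \<ge> 1" by linarith
    have "card A \<le> nat \<lfloor>Y\<rfloor>" using card_mono[OF _ sub] by simp
    then have "real (card A) \<le> real (nat \<lfloor>Y\<rfloor>)" by simp
    also have "\<dots> \<le> Y" using \<open>Y \<ge> 1\<close> by (intro of_nat_floor) simp
    finally show ?thesis .
  qed
  have "real n * \<sigma> / (2 * real j ^ 2) = (real n / real j) ^ 2 * (\<sigma> / (2 * real n))"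
    using n(1) j(1) by (simp add: power2_eq_square)
  then have "(real n * \<sigma> / (2 * real j ^ 2)) ^ j * esym P J =
      ((real n / real j) ^ j) ^ 2 * (esym P J * (\<sigma> / (2 * real n)) ^ j)"
    by (simp only: power_mult_distrib power_mult[symmetric] mult.commute mult.left_commute)
  also have "\<dots> \<le> real (n choose j) ^ 2 * esym P n"
  proof (intro mult_mono power_mono)
    show "(real n / real j) ^ j \<le> real (n choose j)"
      by (rule binomial_ge_n_over_k_pow_k) (simp add: n_def)
    show "esym P J * (\<sigma> / (2 * real n)) ^ j \<le> esym P n"
      using esym_add_ge[OF P(1,4) w, of J j n] n by (simp add: n_def \<sigma>_def)
  qed (use \<sigma> eJ in auto)
  finally have e: "(real n * \<sigma> / (2 * real j ^ 2)) ^ j * esym P J \<le> real (n choose j) ^ 2 * esym P n" .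
  have hE: "h\<^sub>1 \<ge> 0" "E \<ge> 0"
    using V(1) x order_trans[OF of_nat_0_le_iff cardA] by (auto simp: h\<^sub>1_def E_def intro!: sum_nonneg)
  have "E * esym P J * h\<^sub>1 \<le> E * h\<^sub>0 * esym P J"
    using mult_left_mono[OF h0, of "E * esym P J"] hE eJ by (simp add: h\<^sub>1_def mult_ac)
  also have "\<dots> < c\<^sub>1 ^ 2 * x * (real n * \<sigma> / (2 * real j ^ 2)) ^ j * esym P J"
    using V(2) eJ unfolding E_def n_def by (rule mult_strict_right_mono)
  also have "\<dots> = c\<^sub>1 ^ 2 * x * ((real n * \<sigma> / (2 * real j ^ 2)) ^ j * esym P J)"
    by simp
  also have "\<dots> \<le> c\<^sub>1 ^ 2 * x * (real (n choose j) ^ 2 * esym P n)"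
    using x by (intro mult_left_mono e) auto
  also have "\<dots> \<le> T * h\<^sub>1"
    using sum_square_representations_ge[OF P(1,2) H(1,2,4) x c1]
    by (simp add: T_def h\<^sub>1_def C_def A_def M_def n_def mult.assoc)
  finally have T: "E * esym P J < T"
    using hE(1) mult_less_cancel_right[of "E * esym P J" h\<^sub>1 T] by auto
  have "\<exists>\<chi>. dirichlet_character q \<chi> \<and> \<chi> \<noteq> principal_character q \<and>
    norm (\<Sum>m\<in>M. \<chi> (int m)) ^ 2 > V"
  proof (rule resonance_method[OF q finM finA finC _ _ V(1)])
    fix a assume "a \<in> A"
    then obtain s where "a = \<Prod>s" "s \<subseteq> P" "card s = J" by (auto simp: A_def)
    moreover from this have "real a < real q" using Y(1)[of s] Y(2) by simp
    ultimately show "coprime a q \<and> a < q \<and> 0 \<le> 1 / sqrt (real a)"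
      using cop by simp
  next
    fix c assume "c \<in> C"
    then show "coprime c q" using H(3) cop by (auto simp: C_def)
  next
    have "real (card M) ^ 2 * real (card A) \<le> x ^ 2 * Y"
      using cardM cardA by (intro mult_mono power_mono) auto
    then have "V + real (card M) ^ 2 * real (card A) / real (card (characters q)) \<le> E"
      unfolding E_def by (intro add_left_mono divide_right_mono) auto
    then have "(V + real (card M) ^ 2 * real (card A) / real (card (characters q))) * esym P J \<le> E * esym P J"
      using eJ by (intro mult_right_mono) auto
    also note T
    finally show "(V + real (card M) ^ 2 * real (card A) / real (card (characters q))) *
        (\<Sum>a\<in>A. (1 / sqrt (real a)) ^ 2) <
        (\<Sum>c\<in>C. (\<Sum>(m, a)\<in>{(m, a)\<in>M \<times> A. m * a = c}. 1 / sqrt (real a)) ^ 2)"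
      using sum_inverse_products[OF P(1,2)] by (simp add: A_def T_def)
  qed
  then show ?thesis by (simp add: character_sum_def M_def)
qed

section \<open>Choice of the parameters\<close>

text \<open>The constants 1/2 and 2 in the two bounds for the sum of (log p) / p force a window
  exponent above 4. With 8 the difference is \<open>2 * ln W - 1 / 2\<close>; dividing by the
  largest logarithm \<open>8 * ln W\<close> leaves at least 3/16. Prime divisors of \<open>q\<close>
  take away at most \<open>2 * ln q / W \<le> 1 / 16\<close>.\<close>

lemma sum_inverse_primes_ge:
  assumes q: "q > 0" and W: "2 \<le> ln (real W)" "32 * ln (real q) \<le> real W"
  defines "P \<equiv> {p. prime p \<and> W < p \<and> p \<le> W ^ 8 \<and> \<not> p dvd q}"
  shows "1 / 8 \<le> (\<Sum>p\<in>P. 1 / real p)"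
proof -
  define S where "S n = (\<Sum>p | prime p \<and> p \<le> n. ln (real p) / real p)" for n :: nat
  define P' where "P' = {p. prime p \<and> W < p \<and> p \<le> W ^ 8}"
  define D where "D = {p. prime p \<and> p dvd q}"
  have W0: "W > 0" using W(1) by (cases "W = 0") auto
  have fin: "finite P'" "finite D"
    using q by (auto simp: P'_def D_def finite_prime_divisors)
  have le: "W \<le> W ^ 8" using W0 by (intro self_le_power) auto
  have "2 * ln (real W) - 1 / 2 = (ln (real (W ^ 8)) - 1) / 2 - 2 * ln (real W)"
    using W0 by (simp add: ln_realpow)
  also have "\<dots> \<le> S (W ^ 8) - S W"
    using sum_ln_prime_over_prime_lower[of "W ^ 8"] sum_ln_prime_over_prime_upper[of W] W0
    by (intro diff_mono) (auto simp: S_def)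
  also have "\<dots> = (\<Sum>p\<in>P'. ln (real p) / real p)"
  proof -
    have "{p. prime p \<and> p \<le> W ^ 8} - {p. prime p \<and> p \<le> W} = P'" by (auto simp: P'_def)
    then show ?thesis
      unfolding S_def using le by (subst sum_diff[symmetric]) auto
  qed
  also have "\<dots> \<le> (\<Sum>p\<in>P'. 8 * ln (real W) * (1 / real p))"
  proof (intro sum_mono)
    fix p assume p: "p \<in> P'"
    then have "real p \<le> real W ^ 8" "real p > 0"
      using prime_gt_0_nat of_nat_mono[of p "W ^ 8"] by (auto simp: P'_def)
    then have "ln (real p) \<le> ln (real W ^ 8)" using W0 by (subst ln_le_cancel_iff) auto
    also have "\<dots> = 8 * ln (real W)" using W0 by (simp add: ln_realpow)
    finally show "ln (real p) / real p \<le> 8 * ln (real W) * (1 / real p)"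
      using divide_right_mono[of "ln (real p)" "8 * ln (real W)" "real p"] by simp
  qed
  also have "\<dots> = 8 * ln (real W) * (\<Sum>p\<in>P'. 1 / real p)"
    by (simp add: sum_distrib_left)
  finally have "2 * ln (real W) - 1 / 2 \<le> (\<Sum>p\<in>P'. 1 / real p) * (8 * ln (real W))"
    by (simp only: mult.commute)
  moreover have "3 / 16 * (8 * ln (real W)) \<le> 2 * ln (real W) - 1 / 2"
    using W(1) by simp
  ultimately have "3 / 16 * (8 * ln (real W)) \<le> (\<Sum>p\<in>P'. 1 / real p) * (8 * ln (real W))"
    by (rule order_trans[rotated])
  then have 1: "3 / 16 \<le> (\<Sum>p\<in>P'. 1 / real p)"
    by (rule mult_right_le_imp_le) (use W(1) in simp)
  have "(\<Sum>p\<in>P' \<inter> D. 1 / real p) \<le> (\<Sum>p\<in>P' \<inter> D. 1 / real W)"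
    using W0 by (intro sum_mono divide_left_mono) (auto simp: P'_def)
  also have "\<dots> \<le> real (card D) / real W"
    using fin by (auto intro!: divide_right_mono card_mono)
  also have "\<dots> \<le> 2 * ln (real q) / real W"
    using card_prime_divisors_le[OF q] by (intro divide_right_mono) (auto simp: D_def)
  also have "\<dots> \<le> 1 / 16"
    using W(2) W0 by (simp add: field_simps)
  finally have 2: "(\<Sum>p\<in>P' \<inter> D. 1 / real p) \<le> 1 / 16" .
  have "P = P' - D" by (auto simp: P_def P'_def D_def)
  then have "(\<Sum>p\<in>P. 1 / real p) = (\<Sum>p\<in>P'. 1 / real p) - (\<Sum>p\<in>P' \<inter> D. 1 / real p)"
    using sum.Int_Diff[OF fin(1), of "\<lambda>p. 1 / real p" D] by simp
  with 1 2 show ?thesis by simp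
qed

text \<open>Primes below \<open>q\<close> that do not divide \<open>q\<close> are distinct units, so
  Chebyshev's bound minus the number of prime divisors is a lower bound. It far exceeds the square
  root of \<open>q\<close>, which is what the principal character requires.\<close>

lemma card_characters_ge:
  assumes "q \<ge> 2"
  shows "(real q / 2 - 2 - ln (real q)) / ln (real q) - 2 * ln (real q) \<le> real (card (characters q))"
proof -
  define D where "D = {p. prime p \<and> p dvd q}"
  define R where "R = {p::nat. prime p \<and> real p \<le> real q}"
  have finD: "finite D" using assms by (simp add: D_def finite_prime_divisors)
  have "int ` (R - D) \<subseteq> {a\<in>{0..<int q}. coprime a (int q)}"
  proof
    fix a assume "a \<in> int ` (R - D)"
    then obtain p where p: "a = int p" "prime p" "p \<le> q" "\<not> p dvd q" by (auto simp: R_def D_def)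
    then have "p \<noteq> q" by auto
    with p show "a \<in> {a\<in>{0..<int q}. coprime a (int q)}"
      by (auto simp: prime_imp_coprime)
  qed
  moreover have "finite {a\<in>{0..<int q}. coprime a (int q)}"
    by (rule finite_subset[of _ "{0..<int q}"]) auto
  ultimately have "card (int ` (R - D)) \<le> card (characters q)"
    using assms by (subst card_characters) (auto intro!: card_mono)
  then have "card (R - D) \<le> card (characters q)"
    by (simp add: card_image)
  moreover have "card R - card D \<le> card (R - D)"
    using finD by (rule diff_card_le_card_Diff)
  ultimately have "real (card R) - real (card D) \<le> real (card (characters q))"
    by linarith
  moreover have "real (card D) \<le> 2 * ln (real q)"
    using card_prime_divisors_le assms by (simp add: D_def)
  moreover have "(real q / 2 - 2 - ln (real q)) / ln (real q) \<le> real (card R)"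
    using chebyshev_lower[of "real q"] assms by (simp add: R_def divide_le_eq)
  ultimately show ?thesis by linarith
qed

text \<open>Chebyshev's bound up to \<open>X\<close>, with every term at least
  \<open>1 / sqrt X\<close>; \<open>big\<close> makes the primes up to \<open>W\<close> and those
  dividing \<open>q\<close> negligible. Using \<open>ln x\<close> in place of \<open>ln X\<close>
  gives a constant that does not depend on \<open>X\<close>, hence not on the product
  \<open>b\<close> when \<open>X\<close> is \<open>x\<close> divided by it.\<close>

lemma sum_inverse_sqrt_primes_ge:
  fixes x X :: real and q W :: nat
  assumes q: "q > 0" and X: "4 \<le> X" "X \<le> x"
    and big: "8 * ln x * (real W + 2 * ln (real q) + 3) \<le> X"
  shows "sqrt X / (8 * ln x) \<le>
    (\<Sum>h | (prime h \<and> W < h \<and> real h \<le> x \<and> \<not> h dvd q) \<and> real h \<le> X. 1 / sqrt (real h))"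
proof -
  define G where "G = {h. (prime h \<and> W < h \<and> real h \<le> x \<and> \<not> h dvd q) \<and> real h \<le> X}"
  define D where "D = {p. prime p \<and> p dvd q}"
  define R where "R = {p::nat. prime p \<and> real p \<le> X}"
  have lx: "0 < ln X" "ln X \<le> ln x" using X by auto
  have fin: "finite D" "finite R" "finite G"
    using q finite_primes_le[of X] finite_subset[of G R]
    by (auto simp: D_def R_def G_def finite_prime_divisors)
  have "R \<subseteq> G \<union> {..W} \<union> D" using X by (auto simp: R_def G_def D_def)
  then have "card R \<le> card (G \<union> {..W} \<union> D)" using fin by (intro card_mono) auto
  also have "\<dots> \<le> card G + card {..W} + card D"
    by (meson add_mono card_Un_le le_refl order_trans)
  finally have "real (card R) \<le> real (card G) + real W + 1 + real (card D)"
    by simp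
  moreover have "real (card D) \<le> 2 * ln (real q)"
    using card_prime_divisors_le[OF q] by (simp add: D_def)
  ultimately have 1: "real (card R) - (real W + 2 * ln (real q) + 1) \<le> real (card G)"
    by linarith
  have "X / 2 - 2 \<le> (real (card R) + 1) * ln X"
    using chebyshev_lower[of X] X by (simp add: R_def algebra_simps)
  also have "\<dots> \<le> (real (card R) + 1) * ln x"
    using lx by (intro mult_left_mono) auto
  also have "\<dots> \<le> (real (card G) + (real W + 2 * ln (real q) + 2)) * ln x"
    using 1 lx by (intro mult_right_mono) auto
  also have "\<dots> \<le> real (card G) * ln x + X / 8 - ln x"
    using big by (simp add: algebra_simps)
  finally have 2: "X / 2 - X / 8 - 2 \<le> real (card G) * ln x - ln x" by simp
  have "ln x \<ge> 1" using X ln_4_ge ln_mono[of 4 x] by linarith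
  then have "X / 8 \<le> real (card G) * ln x"
    using 2 X(1) by linarith
  then have "X / (8 * ln x) \<le> real (card G)"
    using lx by (simp add: field_simps)
  then have "X / (8 * ln x) / sqrt X \<le> real (card G) / sqrt X"
    using X by (intro divide_right_mono) auto
  also have "\<dots> = (\<Sum>h\<in>G. 1 / sqrt X)" by simp
  also have "\<dots> \<le> (\<Sum>h\<in>G. 1 / sqrt (real h))"
  proof (rule sum_mono)
    fix h assume h: "h \<in> G"
    then have "h > 0" "real h \<le> X" using prime_gt_0_nat by (auto simp: G_def)
    then show "1 / sqrt X \<le> 1 / sqrt (real h)"
      by (intro divide_left_mono) (auto intro: mult_pos_pos)
  qed
  finally have "X / (8 * ln x) / sqrt X \<le> (\<Sum>h\<in>G. 1 / sqrt (real h))" .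
  moreover have "X / (8 * ln x) / sqrt X = X / sqrt X / (8 * ln x)"
    by (simp only: divide_divide_eq_left mult.commute)
  ultimately show ?thesis
    using X by (simp add: G_def real_div_sqrt)
qed

section \<open>Numerical choice of the parameters\<close>

text \<open>\<open>U\<close> is the intended size of \<open>j\<close>. The relation
  \<open>U ^ 2 * ln l = l / L\<close> keeps the products \<open>a\<close> below a small power of
  \<open>q\<close>; \<open>96 * (U * ln l) \<le> lx\<close> keeps products of \<open>j\<close>
  primes below \<open>sqrt x\<close>; the bounds by \<open>U\<close> let \<open>exp U\<close> absorb
  \<open>l ^ 6\<close> and, separately, \<open>L powr (2 * K)\<close>. All follow from
  \<open>l = K ^ 2 * L ^ 2 * ln l\<close>.\<close>

lemma parameter_estimates:
  fixes l lx K L U :: real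
  assumes K_def: "K = l / lx" and L_def: "L = lx / sqrt (l * ln l)" and U_def: "U = K * sqrt L"
    and l: "100 \<le> l" "1296 * ln l ^ 5 \<le> l" and lx: "lx > 0" and K: "8 \<le> K" and L: "100000 \<le> L"
  shows "lx = L ^ 2 * K * ln l" "U ^ 2 * ln l = l / L" "96 * (U * ln l) \<le> lx" "6 * ln l \<le> U"
    "2 * K * ln L \<le> U" "1 \<le> ln l"
proof -
  show ll: "1 \<le> ln l"
    using ln_mono[of 4 l] ln_4_ge l(1) by linarith
  have pos: "l > 0" "ln l > 0" "L > 0" "K > 0" using l ll K L by auto
  have lx_eq: "lx = L * sqrt (l * ln l)"
    using pos by (simp add: L_def)
  have l_eq: "l = K * lx" using lx by (simp add: K_def)
  have "lx ^ 2 = L ^ 2 * (l * ln l)"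
    using pos by (simp add: lx_eq power_mult_distrib)
  also have "l * ln l = K * lx * ln l" by (rule arg_cong[OF l_eq, of "\<lambda>u. u * ln l"])
  finally have "lx * lx = (L ^ 2 * K * ln l) * lx" by (simp add: power2_eq_square mult_ac)
  then show lx_eq': "lx = L ^ 2 * K * ln l" using lx by simp
  have l_eq': "l = K ^ 2 * L ^ 2 * ln l"
    by (subst l_eq, subst lx_eq') (simp add: power2_eq_square)
  have U2: "U ^ 2 = K ^ 2 * L" using pos by (simp add: U_def power_mult_distrib)
  have "l / L = K ^ 2 * L * ln l"
    using pos by (subst l_eq') (simp add: power2_eq_square)
  then show "U ^ 2 * ln l = l / L" by (simp add: U2)
  have sL: "100 \<le> sqrt L" using L by (intro real_le_rsqrt) simp
  have "96 * sqrt L \<le> L * sqrt L"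
    using L sL by (intro mult_right_mono) auto
  also have "\<dots> \<le> L * L"
    using L by (intro mult_left_mono) (auto intro!: real_le_lsqrt simp: power2_eq_square)
  finally have "96 * sqrt L * (K * ln l) \<le> L * L * (K * ln l)"
    using pos by (intro mult_right_mono) auto
  then show "96 * (U * ln l) \<le> lx"
    by (subst lx_eq') (simp add: U_def power2_eq_square mult_ac)
  show "6 * ln l \<le> U"
  \<comment> \<open>Fourth powers are compared: 1296 is \<open>6 ^ 4\<close>, and
    \<open>U ^ 4 = K ^ 4 * L ^ 2\<close>.\<close>
  proof (rule power_le_imp_le_base[where n = 3])
    show "0 \<le> U" using pos by (simp add: U_def)
    have K2: "1 \<le> K ^ 2" using K by simp
    have "(6 * ln l) ^ 4 * ln l \<le> K ^ 2 * L ^ 2 * ln l"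
      using l(2) by (subst l_eq'[symmetric]) (simp add: power_mult_distrib eval_nat_numeral mult_ac)
    then have "(6 * ln l) ^ 4 \<le> 1 * (K ^ 2 * L ^ 2)" using pos by simp
    also have "\<dots> \<le> K ^ 2 * (K ^ 2 * L ^ 2)"
      using K2 by (intro mult_right_mono) auto
    also have "\<dots> = (U ^ 2) ^ 2"
      unfolding U2 by (simp add: power2_eq_square)
    finally show "(6 * ln l) ^ Suc 3 \<le> U ^ Suc 3" by simp
  qed
  \<comment> \<open>With the fourth root \<open>s\<close>, the crude \<open>ln s \<le> s\<close>
    already yields a bound for \<open>ln L\<close> by \<open>sqrt L\<close>.\<close>
  define s where "s = sqrt (sqrt L)"
  have s: "s > 0" "sqrt L = s ^ 2" using pos by (auto simp: s_def)
  have "8 \<le> s" unfolding s_def using sL L by (intro real_le_rsqrt) simp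
  have "L = s ^ 4"
    using pos s by (metis power_mult real_sqrt_pow2 less_imp_le mult_2 numeral_Bit0)
  then have "ln L = 4 * ln s" using s by (simp add: ln_realpow)
  also have "\<dots> \<le> 4 * s" using ln_less_self[OF s(1)] by simp
  also have "\<dots> \<le> s ^ 2 / 2" using \<open>8 \<le> s\<close> by (simp add: power2_eq_square)
  finally have "2 * ln L \<le> sqrt L" by (simp add: s)
  then have "K * (2 * ln L) \<le> K * sqrt L" using pos by (intro mult_left_mono) auto
  then show "2 * K * ln L \<le> U" by (simp add: U_def)
qed

lemma prod_subset_le_power:
  fixes P :: "nat set"
  assumes "\<And>p. p \<in> P \<Longrightarrow> real p \<le> B" "a \<subseteq> P"
  shows "real (\<Prod>a) \<le> B ^ card a"
proof -
  have "real (\<Prod>a) = (\<Prod>p\<in>a. real p)" by (simp add: of_nat_prod)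
  also have "\<dots> \<le> (\<Prod>p\<in>a. B)" using assms by (intro prod_mono) auto
  finally show ?thesis by simp
qed

text \<open>The theorem for one modulus with explicit thresholds. \<open>K \<ge> 8\<close> means
  \<open>x \<le> exp (l / 8)\<close>; the third condition on \<open>l\<close> makes the number of
  characters at least \<open>exp (l / 2)\<close>; 100000 is chosen so that
  \<open>24 * 256 * 4 / 100000 \<le> 1 / 4\<close>.\<close>

lemma large_character_sum:
  fixes q :: nat and x l K L :: real
  defines "l \<equiv> ln (real q)"
  defines "K \<equiv> l / ln x" and "L \<equiv> ln x / sqrt (l * ln l)"
  assumes l: "100 \<le> l" "1296 * ln l ^ 5 \<le> l" "exp (l / 2) \<le> (exp l / 2 - 2 - l) / l - 2 * l"
    and x: "x > 0" and K: "8 \<le> K" and L: "100000 \<le> L"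
  shows "\<exists>\<chi>. dirichlet_character q \<chi> \<and> \<chi> \<noteq> principal_character q \<and>
    sqrt x * L powr K \<le> norm (character_sum \<chi> x)"
proof -
  define lx where "lx = ln x"
  define ll where "ll = ln l"
  define U where "U = K * sqrt L"
  have q: "q > 0" using l(1) by (cases "q = 0") (auto simp: l_def)
  have ql: "real q = exp l" using q by (simp add: l_def)
  have "0 < l / lx" using K by (simp add: K_def lx_def)
  then have lx: "lx > 0" using l(1) by (simp add: zero_less_divide_iff)
  have xl: "x = exp lx" using x by (simp add: lx_def)
  have eqs: "K = l / lx" "L = lx / sqrt (l * ln l)" "U = K * sqrt L"
    by (simp_all add: K_def L_def U_def lx_def)
  note est = parameter_estimates[OF eqs l(1,2) lx K L, folded ll_def]
  have ll: "1 \<le> ll" and lll: "l = exp ll" using est(6) l(1) by (auto simp: ll_def)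
  have U: "6 \<le> U" using est(4) ll by linarith
  have lxl: "8 * lx \<le> l" using K lx by (simp add: K_def lx_def field_simps)
  \<comment> \<open>\<open>W\<close> has to exceed large multiples of \<open>l\<close> and of
    \<open>j ^ 2\<close>, while \<open>W \<le> l ^ 3\<close> bounds all primes of the window by
    \<open>l ^ 24 = exp (24 * ll)\<close>.\<close>
  define W where "W = nat \<lceil>l ^ 2\<rceil>"
  have W: "l ^ 2 \<le> real W" "real W \<le> l ^ 3"
  proof -
    show "l ^ 2 \<le> real W" unfolding W_def by linarith
    have "real W \<le> l ^ 2 + 1" unfolding W_def by (simp add: of_nat_ceiling)
    also have "\<dots> \<le> 2 * l ^ 2" using l(1) one_le_power[of l 2] by simp
    also have "\<dots> \<le> l * l ^ 2" using l(1) by (intro mult_right_mono) auto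
    finally show "real W \<le> l ^ 3" by (simp add: eval_nat_numeral)
  qed
  have lW: "2 \<le> ln (real W)"
  proof -
    have "2 \<le> 2 * ll" using ll by simp
    also have "\<dots> = ln (l ^ 2)" using l(1) by (simp add: ll_def ln_realpow)
    also have "\<dots> \<le> ln (real W)" using W(1) l(1) by (intro ln_mono) auto
    finally show ?thesis .
  qed
  have W8: "real (W ^ 8) \<le> l ^ 24"
    using power_mono[OF W(2), of 8] by (simp add: power_mult[symmetric])
  have l24: "l ^ 24 = exp (24 * ll)" by (simp add: lll exp_of_nat_mult[symmetric])
  have llW: "l * 100 \<le> real W"
    by (rule order_trans[OF _ W(1)]) (use l(1) in \<open>simp add: power2_eq_square\<close>)
  define j where "j = nat \<lceil>U\<rceil>"
  have j: "U \<le> real j" "real j \<le> 2 * U" "j > 0"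
    using U unfolding j_def by linarith+
  \<comment> \<open>Makes \<open>(J + j) * \<sigma> / (2 * j ^ 2) = 128 * \<sigma> \<ge> 16\<close>,
    above \<open>exp 2\<close>. The subtraction does not truncate, as
    \<open>j \<le> j ^ 2\<close>.\<close>
  define J where "J = 256 * j ^ 2 - j"
  have Jj: "J + j = 256 * j ^ 2"
    using self_le_power[of j 2] j(3) by (simp add: J_def)
  have j2: "real j ^ 2 * ll \<le> 4 * (l / L)"
  proof -
    have "real j ^ 2 \<le> (2 * U) ^ 2" using j by (intro power_mono) auto
    then have "real j ^ 2 * ll \<le> (2 * U) ^ 2 * ll" using ll by (intro mult_right_mono) auto
    then show ?thesis using est(2) by (simp add: power_mult_distrib)
  qed
  define P where "P = {p. prime p \<and> W < p \<and> p \<le> W ^ 8 \<and> \<not> p dvd q}"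
  define \<sigma> where "\<sigma> = (\<Sum>p\<in>P. 1 / real p)"
  have \<sigma>: "1 / 8 \<le> \<sigma>"
    unfolding \<sigma>_def P_def using llW l(1) by (intro sum_inverse_primes_ge q lW) (auto simp: l_def)
  have finP: "finite P" by (rule finite_subset[of _ "{..W ^ 8}"]) (auto simp: P_def)
  have prodP: "real (\<Prod>a) \<le> exp (24 * ll * real (card a))" if "a \<subseteq> P" for a
  proof -
    have "real p \<le> exp (24 * ll)" if "p \<in> P" for p
    proof -
      have "real p \<le> real (W ^ 8)" using that unfolding P_def of_nat_le_iff by simp
      also note W8
      finally show ?thesis by (simp add: l24)
    qed
    from prod_subset_le_power[OF this that] show ?thesis
      by (simp add: exp_of_nat_mult[symmetric] mult.commute)
  qed
  define H where "H = {h. prime h \<and> W ^ 8 < h \<and> real h \<le> x \<and> \<not> h dvd q}"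
  define N where "N = real (card (characters q))"
  have N: "exp (l / 2) \<le> N"
    using card_characters_ge[of q] l q by (cases "q = 1") (auto simp: N_def l_def)
  define V where "V = x * L powr (2 * K)"
  have LK: "1 \<le> L powr (2 * K)" using L K by (intro ge_one_powr_ge_zero) auto
  have "\<exists>\<chi>. dirichlet_character q \<chi> \<and> \<chi> \<noteq> principal_character q \<and>
    norm (character_sum \<chi> x) ^ 2 > V"
  \<comment> \<open>\<open>x ^ 2 * exp (l / 4) \<le> exp (l / 2)\<close> keeps the principal term at
    most 1. The value \<open>2 * lx\<close> comes from the upper bound for the sum of (log p) / p,
    and \<open>1 / (8 * lx)\<close> from the sum over primes \<open>h\<close>.\<close>
  proof (rule large_character_sum_of_resonator[where P = P and H = H and J = J and j = j and
        w = "real W" and Y = "exp (l / 4)" and c\<^sub>1 = "1 / (8 * lx)" and h\<^sub>0 = "2 * lx"])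
    show "q > 0" "finite P" "j > 0" by fact+
    show "prime p" "\<not> p dvd q" "real W \<le> real p" if "p \<in> P" for p
      using that by (auto simp: P_def)
    show "0 < real W" using llW l(1) by linarith
    show "2 * real (J + j) \<le> (\<Sum>p\<in>P. 1 / real p) * real W"
    proof -
      have "real j ^ 2 * 1 \<le> real j ^ 2 * ll" using ll by (intro mult_left_mono) auto
      also note j2
      also have "4 * (l / L) \<le> 4 * (l / 100000)"
        using L l(1) by (intro mult_left_mono divide_left_mono) auto
      finally have "4096 * real j ^ 2 \<le> real W" using llW l(1) by linarith
      then have "2 * real (J + j) \<le> 1 / 8 * real W" by (simp add: Jj)
      also have "\<dots> \<le> \<sigma> * real W" using \<sigma> by (intro mult_right_mono) auto
      finally show ?thesis by (simp add: \<sigma>_def)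
    qed
    show "finite H"
      by (rule finite_subset[of _ "{..nat \<lfloor>x\<rfloor>}"]) (auto simp: H_def intro: le_nat_floor)
    show "h > 0" "coprime h q" if "h \<in> H" for h
      using that by (auto simp: H_def prime_gt_0_nat prime_imp_coprime)
    show "\<not> p dvd h" if "h \<in> H" "p \<in> P" for h p
      using that primes_dvd_imp_eq[of p h] by (auto simp: H_def P_def)
    show "(\<Sum>h\<in>H. 1 / real h) \<le> 2 * lx"
    proof -
      define X where "X = nat \<lfloor>x\<rfloor>"
      have x1: "x \<ge> 1" using lx xl by simp
      \<comment> \<open>Inserting \<open>ln h \<ge> 1\<close> loses only a logarithm, which the
        exponential gain in \<open>j\<close> absorbs.\<close>
      have "(\<Sum>h\<in>H. 1 / real h) \<le> (\<Sum>h\<in>H. ln (real h) / real h)"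
      proof (intro sum_mono divide_right_mono)
        fix h assume "h \<in> H"
        then have "W ^ 8 < h" by (simp add: H_def)
        moreover have "W > 4" using llW l(1) by linarith
        then have "W \<le> W ^ 8" by (intro self_le_power) auto
        ultimately have "4 \<le> real h" using \<open>W > 4\<close> by linarith
        then show "1 \<le> ln (real h)" using ln_4_ge ln_mono[of 4 "real h"] by linarith
      qed simp
      also have "\<dots> \<le> (\<Sum>p | prime p \<and> p \<le> X. ln (real p) / real p)"
      proof (rule sum_mono2)
        show "H \<subseteq> {p. prime p \<and> p \<le> X}" by (auto simp: H_def X_def intro: le_nat_floor)
        show "0 \<le> ln (real p) / real p" if "p \<in> {p. prime p \<and> p \<le> X} - H" for p
          using that prime_ge_1_nat[of p] by (intro divide_nonneg_nonneg ln_ge_zero) auto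
      qed simp
      also have "\<dots> \<le> 2 * ln (real X)"
        by (rule sum_ln_prime_over_prime_upper)
      also have "\<dots> \<le> 2 * lx"
        unfolding lx_def using x1 by (intro mult_left_mono ln_mono) (auto simp: X_def of_nat_floor)
      finally show ?thesis .
    qed
    show "real (\<Prod>a) \<le> exp (l / 4)" if "a \<subseteq> P" "card a = J" for a
    proof -
      have "real J \<le> 256 * real j ^ 2"
        using Jj by (metis le_add1 of_nat_le_iff of_nat_mult of_nat_numeral of_nat_power)
      then have "24 * ll * real J \<le> 24 * ll * (256 * real j ^ 2)"
        using ll by (intro mult_left_mono) auto
      also have "\<dots> = 6144 * (real j ^ 2 * ll)" by simp
      also have "\<dots> \<le> 6144 * (4 * (l / L))" using j2 by simp
      also have "\<dots> \<le> 6144 * (4 * (l / 100000))"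
        using L l(1) by (intro mult_left_mono divide_left_mono) auto
      also have "\<dots> \<le> l / 4" using l(1) by simp
      finally have "exp (24 * ll * real (card a)) \<le> exp (l / 4)" by (simp add: that)
      with prodP[OF that(1)] show ?thesis by linarith
    qed
    show "exp (l / 4) < real q" using l(1) by (simp add: ql)
    show "0 \<le> x" "0 \<le> 1 / (8 * lx)" using x lx by auto
    show "1 / (8 * lx) * sqrt (x / real (\<Prod>b)) \<le> (\<Sum>h | h \<in> H \<and> real (h * \<Prod>b) \<le> x. 1 / sqrt (real h))"
      if b: "b \<subseteq> P" "card b = j" for b
    proof -
      define X where "X = x / real (\<Prod>b)"
      have "\<Prod>b > 0" using b by (intro prod_primes_pos) (auto simp: P_def)
      then have pos: "1 \<le> real (\<Prod>b)" by linarith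
      have "24 * ll * real j \<le> 24 * ll * (2 * U)" using ll j by (intro mult_left_mono) auto
      also have "\<dots> \<le> lx / 2" using est(3) by (simp add: mult_ac)
      finally have "real (\<Prod>b) \<le> exp (lx / 2)"
        using prodP[OF b(1)] b(2) by (meson exp_le_cancel_iff order_trans)
      then have "exp lx / exp (lx / 2) \<le> X"
        unfolding X_def xl using pos by (intro divide_left_mono) auto
      then have X1: "exp (lx / 2) \<le> X" by (simp add: exp_diff[symmetric])
      have X2: "X \<le> x" unfolding X_def using pos x by (simp add: field_simps mult_le_cancel_left1)
      \<comment> \<open>Leads to \<open>l ^ 26 \<le> sqrt x \<le> X\<close>, two powers of
        \<open>l\<close> above the bound for \<open>W ^ 8\<close>: one pays for
        \<open>8 * ln x\<close>, the other for the numerical constant.\<close>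
      have "52 * ll \<le> L ^ 2 * K * ll"
      proof (rule mult_right_mono)
        have "100 * 1 \<le> L ^ 2 * K"
          using L K power_mono[of 10 L 2] by (intro mult_mono) auto
        then show "52 \<le> L ^ 2 * K" by simp
      qed (use ll in simp)
      then have "exp (26 * ll) \<le> exp (lx / 2)" using est(1) by simp
      then have "exp (26 * ll) \<le> X" using X1 by (rule order_trans)
      then have X3: "l ^ 26 \<le> X" by (simp add: lll exp_of_nat_mult[symmetric])
      have "8 * ln x * (real (W ^ 8) + 2 * ln (real q) + 3) \<le> l * (l ^ 24 + 2 * l + 3)"
        using W8 lxl lx l(1) by (intro mult_mono) (auto simp: l_def lx_def)
      also have "\<dots> \<le> l * (l ^ 24 + l ^ 24 * 6)"
      proof -
        have "l \<le> l ^ 24" "1 \<le> l ^ 24" using l(1) by (auto intro: self_le_power one_le_power)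
        then have "2 * l + 3 \<le> l ^ 24 * 6" by linarith
        then show ?thesis using l(1) by (intro mult_left_mono) auto
      qed
      also have "\<dots> = 7 * l ^ 25" by (simp add: eval_nat_numeral)
      also have "\<dots> \<le> l * l ^ 25" using l(1) by (intro mult_right_mono) auto
      also have "\<dots> = l ^ 26" by (simp add: eval_nat_numeral)
      also note X3
      finally have big: "8 * ln x * (real (W ^ 8) + 2 * ln (real q) + 3) \<le> X" .
      have "4 \<le> X"
      proof -
        have "4 \<le> l" using l(1) by simp
        also have "l \<le> l ^ 26" using l(1) by (intro self_le_power) auto
        also note X3
        finally show ?thesis .
      qed
      from sum_inverse_sqrt_primes_ge[OF q this X2 big]
      have "sqrt X / (8 * lx) \<le> (\<Sum>h | h \<in> H \<and> real h \<le> X. 1 / sqrt (real h))"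
        by (simp add: H_def lx_def)
      moreover have "{h. h \<in> H \<and> real h \<le> X} = {h. h \<in> H \<and> real (h * \<Prod>b) \<le> x}"
        using pos by (auto simp: X_def field_simps)
      ultimately show ?thesis by (simp add: X_def)
    qed
    show "0 \<le> V" using x by (simp add: V_def)
    show "(V + x ^ 2 * exp (l / 4) / real (card (characters q))) * (2 * lx) <
        (1 / (8 * lx)) ^ 2 * x * (real (J + j) * (\<Sum>p\<in>P. 1 / real p) / (2 * real j ^ 2)) ^ j"
    proof -
      have "x ^ 2 * exp (l / 4) \<le> exp (l / 2)"
        using lxl by (simp add: xl exp_of_nat_mult[symmetric] exp_add[symmetric])
      then have "x ^ 2 * exp (l / 4) / N \<le> 1"
        using N exp_gt_zero[of "l / 2"] by (subst divide_le_eq_1) linarith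
      also have "1 \<le> V"
        using mult_mono[of 1 x 1 "L powr (2 * K)"] LK lx by (simp add: V_def xl)
      finally have "(V + x ^ 2 * exp (l / 4) / N) * (2 * lx) \<le> (2 * V) * (2 * lx)"
        using lx by (intro mult_right_mono) auto
      also have "\<dots> = (256 * lx ^ 3 * L powr (2 * K)) * (x / (64 * lx ^ 2))"
        using lx by (simp add: V_def field_simps eval_nat_numeral)
      \<comment> \<open>Two factors \<open>exp U\<close> are spent, one on
        \<open>256 * lx ^ 3\<close> and one on \<open>L powr (2 * K)\<close>;
        \<open>U \<le> j\<close> and \<open>exp 1 \<le> 3\<close> bound their product by
        \<open>9 ^ j\<close>.\<close>
      also have "\<dots> < 16 ^ j * (x / (64 * lx ^ 2))"
      proof (rule mult_strict_right_mono)
        have "256 * lx ^ 3 \<le> 256 * l ^ 3"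
          using lxl lx by (intro mult_left_mono power_mono) auto
        also have "\<dots> < l ^ 3 * l ^ 3"
        proof (rule mult_strict_right_mono)
          have "(100::real) ^ 3 \<le> l ^ 3" using l(1) by (intro power_mono) auto
          then show "256 < l ^ 3" by simp
        qed (use l(1) in simp)
        also have "\<dots> = exp (6 * ll)"
          by (simp add: lll exp_of_nat_mult[symmetric] exp_add[symmetric])
        also have "\<dots> \<le> exp U" using est(4) by simp
        finally have 1: "256 * lx ^ 3 < exp U" .
        have "L powr (2 * K) = exp (2 * K * ln L)" using L by (simp add: powr_def)
        also have "\<dots> \<le> exp U" using est(5) by simp
        finally have "256 * lx ^ 3 * L powr (2 * K) \<le> 256 * lx ^ 3 * exp U"
          using lx by (intro mult_left_mono) auto
        also have "\<dots> < exp U * exp U" using 1 by (intro mult_strict_right_mono) auto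
        also have "\<dots> \<le> exp (real j) * exp (real j)" using j by (intro mult_mono) auto
        also have "\<dots> = (exp 1 * exp 1) ^ j"
          by (simp add: power_mult_distrib exp_of_nat_mult[symmetric])
        also have "\<dots> \<le> 16 ^ j"
          using exp_le mult_mono[of "exp 1" 3 "exp 1" "3::real"] by (intro power_mono) auto
        finally show "256 * lx ^ 3 * L powr (2 * K) < 16 ^ j" .
      qed (use x lx in simp)
      also have "\<dots> \<le> (128 * \<sigma>) ^ j * (x / (64 * lx ^ 2))"
        using \<sigma> x by (intro mult_right_mono power_mono) auto
      also have "128 * \<sigma> = real (J + j) * \<sigma> / (2 * real j ^ 2)"
        using j(3) by (simp add: Jj)
      also have "x / (64 * lx ^ 2) = (1 / (8 * lx)) ^ 2 * x"
        by (simp add: power_divide power_mult_distrib)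
      also note mult.commute
      finally show ?thesis by (simp add: N_def \<sigma>_def)
    qed
  qed
  then obtain \<chi> where \<chi>: "dirichlet_character q \<chi>" "\<chi> \<noteq> principal_character q"
    "V < norm (character_sum \<chi> x) ^ 2" by blast
  have "L powr (2 * K) = (L powr K) ^ 2"
    using powr_add[of L K K] unfolding mult_2 power2_eq_square[of "L powr K"] .
  then have "(sqrt x * L powr K) ^ 2 = V"
    using x by (simp add: V_def power_mult_distrib)
  then have "(sqrt x * L powr K) ^ 2 \<le> norm (character_sum \<chi> x) ^ 2"
    using \<chi>(3) by linarith
  then have "sqrt x * L powr K \<le> norm (character_sum \<chi> x)"
    by (rule power2_le_imp_le) simp
  with \<chi>(1,2) show ?thesis by (intro exI[of _ \<chi>] conjI)
qed

theorem theorem6: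
  shows "\<exists>c::real. c > 0 \<and>
    (\<forall>x :: nat \<Rightarrow> real.
       (\<forall>\<^sub>F q in sequentially. x q > 0) \<longrightarrow>
       filterlim (\<lambda>q. ln (real q) / ln (x q)) at_top sequentially \<longrightarrow>
       filterlim (\<lambda>q. ln (x q) / sqrt (ln (real q) * ln (ln (real q)))) at_top sequentially \<longrightarrow>
       (\<exists>\<epsilon> :: nat \<Rightarrow> real. \<epsilon> \<longlonglongrightarrow> 0 \<and>
          (\<forall>\<^sub>F q in sequentially. \<exists>\<chi>.
             dirichlet_character q \<chi> \<and> \<chi> \<noteq> principal_character q \<and>
             1 / sqrt (x q) * norm (character_sum \<chi> (x q))
               \<ge> c * (ln (x q) / sqrt (ln (real q) * ln (ln (real q))))
                       powr ((1 + \<epsilon> q) * (ln (real q) / ln (x q))))))"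
proof (intro exI[of _ 1] conjI allI impI, simp)
  fix x :: "nat \<Rightarrow> real"
  assume pos: "\<forall>\<^sub>F q in sequentially. x q > 0"
    and K: "filterlim (\<lambda>q. ln (real q) / ln (x q)) at_top sequentially"
    and L: "filterlim (\<lambda>q. ln (x q) / sqrt (ln (real q) * ln (ln (real q)))) at_top sequentially"
  have "\<forall>\<^sub>F l :: real in at_top. 1296 * ln l ^ 5 \<le> l" by real_asymp
  moreover have "\<forall>\<^sub>F l :: real in at_top. exp (l / 2) \<le> (exp l / 2 - 2 - l) / l - 2 * l" by real_asymp
  \<comment> \<open>Conditions on the modulus alone are stated in \<open>l\<close>, then pulled back
    along \<open>l = ln q\<close>, which tends to infinity.\<close>
  ultimately have ev: "\<forall>\<^sub>F l :: real in at_top. 100 \<le> l \<and> 1296 * ln l ^ 5 \<le> l \<and>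
      exp (l / 2) \<le> (exp l / 2 - 2 - l) / l - 2 * l"
    by (intro eventually_conj eventually_ge_at_top)
  have "filterlim (\<lambda>q. ln (real q)) at_top sequentially" by real_asymp
  from eventually_compose_filterlim[OF ev this] pos
    filterlim_at_top[THEN iffD1, rule_format, OF K, of 8]
    filterlim_at_top[THEN iffD1, rule_format, OF L, of 100000]
  have "\<forall>\<^sub>F q in sequentially. \<exists>\<chi>.
      dirichlet_character q \<chi> \<and> \<chi> \<noteq> principal_character q \<and>
      1 / sqrt (x q) * norm (character_sum \<chi> (x q))
        \<ge> 1 * (ln (x q) / sqrt (ln (real q) * ln (ln (real q))))
               powr ((1 + 0) * (ln (real q) / ln (x q)))"
  proof eventually_elim
    case (elim q)
    from large_character_sum[of q "x q"] elim obtain \<chi> where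
      "dirichlet_character q \<chi>" "\<chi> \<noteq> principal_character q"
      "sqrt (x q) * (ln (x q) / sqrt (ln (real q) * ln (ln (real q)))) powr (ln (real q) / ln (x q))
        \<le> norm (character_sum \<chi> (x q))" by blast
    with elim(2) show ?case
      by (intro exI[of _ \<chi>]) (simp add: field_simps)
  qed
  then show "\<exists>\<epsilon> :: nat \<Rightarrow> real. \<epsilon> \<longlonglongrightarrow> 0 \<and> (\<forall>\<^sub>F q in sequentially. \<exists>\<chi>.
      dirichlet_character q \<chi> \<and> \<chi> \<noteq> principal_character q \<and>
      1 / sqrt (x q) * norm (character_sum \<chi> (x q))
        \<ge> 1 * (ln (x q) / sqrt (ln (real q) * ln (ln (real q))))
               powr ((1 + \<epsilon> q) * (ln (real q) / ln (x q))))"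
    by (intro exI[of _ "\<lambda>_. 0"] conjI) auto
qed

end
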